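(* There exists an absolute constant $C\ge 1$ ($C=49$ works) such that the following holds. Let $g$ be a U-shaped function on a compact real interval $I=[a,b]$ and let $X$ be a random variable whose law depends on $g$. Let $\widehat G$ be an estimator, based on $X$ and taking values in $\mathcal{H}(I)$, of the function $G(t)=\int_a^t g(s)\,ds$, $t\in I$. Set $Z=\widehat G-G$ and $\widetilde g=U_S(\widehat G)$. Then $$\mathbb{E}\|\widetilde g-g\|\le\inf_{\pi\in\Pi(I)}\mathcal{R}_Z(\pi),$$ where $$\mathcal{R}_Z(\pi)=4\,d(g,\mathcal{H}_\pi)+C\sum_{k\in\mathcal{K}^\pi}\mathbb{E}\left(\sup_{t\in[t_{k-1}^\pi,t_k^\pi]}|Z(t)-Z(t_{k-1}^\pi)|\right).$$
   Context: A function $g$ on $I=[a,b]$ is U-shaped if there is some $m\in I$ such that $g$ is nonincreasing on $[a,m]$ and nondecreasing on $[m,b]$. $\mathcal{H}(I)$ is the cone of nondecreasing, right-continuous with left-hand limits (cadlag) step functions on $I$. An estimator $\widehat G\in\mathcal{H}(I)$ based on $X$ is a (measurable) function of $X$ with values in $\mathcal{H}(I)$. U-shaped regularization: for $F\in\mathcal{H}(I)$ and $m\in I$, $\widetilde F_S^m$ is the function on $I$ defined on $[a,m]$ as the least concave majorant of the restriction of $F$ to $[a,m]$, and on $[m,b]$ as the greatest convex minorant of the restriction of $F$ to $[m,b]$. $U_S^m(F)$ is the right-hand continuous slope (right-hand derivative) of $\widetilde F_S^m$. The mapping $U_S$: let $d_S(m)=\sup_{t\in I}|F(t)-\widetilde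 F_S^m(t)|$ for $m\in I$. This is a cadlag step function on $I$ whose discontinuity points belong to the set of discontinuity points of $F$. Let $m(F)$ be the midpoint of the interval where $d_S$ achieves its minimum. Then $U_S(F)=U_S^{m(F)}(F)$. Norm and distance: $\|f-g\|=\int_I|f(t)-g(t)|\,dt$ and, for $\mathcal{H}\subset\mathbb{L}_1(I)$, $d(f,\mathcal{H})=\inf_{h\in\mathcal{H}}\|f-h\|$. Partitions: $\Pi(I)$ is the set of all finite partitions $\pi=([t_{k-1}^\pi,t_k^\pi))_{k\in\mathcal{K}^\pi}$ of $I$ into intervals, where $a=t_0^\pi<\cdots<t_{D^\pi}^\pi=b$, $\mathcal{K}^\pi=\{1,\dots,D^\pi\}$ and $D^\pi$ is an arbitrary positive integer. $\mathcal{H}_\pi$ is the set of cadlag step functions on $I$ that are constant on every $[t_{k-1}^\pi,t_k^\pi)$, $k\in\mathcal{K}^\pi$. *)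

theory Defs
  imports "HOL-Probability.Probability"
begin

text \<open>Functions on \<open>I = [a, b]\<close> are total functions \<^typ>\<open>real \<Rightarrow> real\<close>; no notion below
  depends on their values outside \<open>I\<close>.\<close>

definition u_shaped :: "real \<Rightarrow> real \<Rightarrow> (real \<Rightarrow> real) \<Rightarrow> bool" where
  "u_shaped a b g \<longleftrightarrow> (\<exists>m\<in>{a..b}. antimono_on {a..m} g \<and> mono_on {m..b} g)"

text \<open>A partition is the list \<open>[t 0, \<dots>, t D]\<close> of its breakpoints, with \<open>D \<ge> 1\<close>; the index
  set of its cells \<open>[t (k - 1), t k)\<close> is \<open>{1..D} = {1..<length ts}\<close>.\<close>

definition partitions :: "real \<Rightarrow> real \<Rightarrow> real list set" where
  "partitions a b =
     {ts. 2 \<le> length ts \<and> sorted_wrt (<) ts \<and> hd ts = a \<and> last ts = b}"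

definition step_on :: "real \<Rightarrow> real \<Rightarrow> (real \<Rightarrow> real) \<Rightarrow> bool" where
  "step_on a b F \<longleftrightarrow>
     (\<exists>ts\<in>partitions a b. \<forall>k\<in>{1..<length ts}. F constant_on {ts ! (k - 1)<..<ts ! k})"

definition cadlag_on :: "real \<Rightarrow> real \<Rightarrow> (real \<Rightarrow> real) \<Rightarrow> bool" where
  "cadlag_on a b F \<longleftrightarrow>
     (\<forall>t\<in>{a..<b}. (F \<longlongrightarrow> F t) (at_right t)) \<and>
     (\<forall>t\<in>{a<..b}. \<exists>l. (F \<longlongrightarrow> l) (at_left t))"

definition mono_steps :: "real \<Rightarrow> real \<Rightarrow> (real \<Rightarrow> real) set" where
  "mono_steps a b = {F. mono_on {a..b} F \<and> cadlag_on a b F \<and> step_on a b F}"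

text \<open>The value at \<open>b\<close> is unconstrained, here and in \<^const>\<open>mono_steps\<close> (a cadlag function on
  \<open>[a, b]\<close> may jump at \<open>b\<close>).\<close>

definition steps_of :: "real \<Rightarrow> real \<Rightarrow> real list \<Rightarrow> (real \<Rightarrow> real) set" where
  "steps_of a b ts =
     {h. cadlag_on a b h \<and> step_on a b h \<and>
         (\<forall>k\<in>{1..<length ts}. h constant_on {ts ! (k - 1)..<ts ! k})}"

definition least_concave_majorant ::
    "real set \<Rightarrow> (real \<Rightarrow> real) \<Rightarrow> real \<Rightarrow> real" where
  "least_concave_majorant S F t =
     Inf {h t | h. concave_on S h \<and> (\<forall>s\<in>S. F s \<le> h s)}"

definition greatest_convex_minorant ::
    "real set \<Rightarrow> (real \<Rightarrow> real) \<Rightarrow> real \<Rightarrow> real" where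
  "greatest_convex_minorant S F t =
     Sup {h t | h. convex_on S h \<and> (\<forall>s\<in>S. h s \<le> F s)}"

text \<open>For nondecreasing \<open>F\<close> both branches take the value \<open>F m\<close> at \<open>m\<close>.\<close>

definition U_reg :: "real \<Rightarrow> real \<Rightarrow> real \<Rightarrow> (real \<Rightarrow> real) \<Rightarrow> real \<Rightarrow> real" where
  "U_reg a b m F t =
     (if t \<le> m then least_concave_majorant {a..m} F t
      else greatest_convex_minorant {m..b} F t)"

text \<open>The right-hand derivative is meaningful on \<open>[a, b)\<close>; the value at \<open>b\<close> is arbitrary.\<close>

definition U_slope :: "real \<Rightarrow> real \<Rightarrow> real \<Rightarrow> (real \<Rightarrow> real) \<Rightarrow> real \<Rightarrow> real" where
  "U_slope a b m F t = vector_derivative (U_reg a b m F) (at_right t)"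

definition d_S :: "real \<Rightarrow> real \<Rightarrow> (real \<Rightarrow> real) \<Rightarrow> real \<Rightarrow> real" where
  "d_S a b F m = (SUP t\<in>{a..b}. \<bar>F t - U_reg a b m F t\<bar>)"

definition argmin_d_S :: "real \<Rightarrow> real \<Rightarrow> (real \<Rightarrow> real) \<Rightarrow> real set" where
  "argmin_d_S a b F = {m\<in>{a..b}. \<forall>m'\<in>{a..b}. d_S a b F m \<le> d_S a b F m'}"

text \<open>For \<open>F\<close> in \<^const>\<open>mono_steps\<close> the set of minimizers is a nonempty interval: \<^const>\<open>d_S\<close>
  takes finitely many values and is the maximum of a nondecreasing and a nonincreasing function.\<close>

definition U_mode :: "real \<Rightarrow> real \<Rightarrow> (real \<Rightarrow> real) \<Rightarrow> real" where
  "U_mode a b F = midpoint (Inf (argmin_d_S a b F)) (Sup (argmin_d_S a b F))"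

definition U_S :: "real \<Rightarrow> real \<Rightarrow> (real \<Rightarrow> real) \<Rightarrow> real \<Rightarrow> real" where
  "U_S a b F = U_slope a b (U_mode a b F) F"

definition L1_dist :: "real \<Rightarrow> real \<Rightarrow> (real \<Rightarrow> real) \<Rightarrow> (real \<Rightarrow> real) \<Rightarrow> ennreal" where
  "L1_dist a b f g = (\<integral>\<^sup>+t\<in>{a..b}. ennreal \<bar>f t - g t\<bar> \<partial>lborel)"

definition L1_setdist ::
    "real \<Rightarrow> real \<Rightarrow> (real \<Rightarrow> real) \<Rightarrow> (real \<Rightarrow> real) set \<Rightarrow> ennreal" where
  "L1_setdist a b f H = (INF h\<in>H. L1_dist a b f h)"

definition primitive :: "real \<Rightarrow> (real \<Rightarrow> real) \<Rightarrow> real \<Rightarrow> real" where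
  "primitive a g t = (LINT s:{a..t}|lborel. g s)"

text \<open>Measurability of a function-valued map is with respect to the \<open>\<sigma>\<close>-algebra generated by
  the evaluations at the points of \<open>I\<close>.\<close>

definition estimator :: "real \<Rightarrow> real \<Rightarrow> 'x measure \<Rightarrow> ('x \<Rightarrow> real \<Rightarrow> real) \<Rightarrow> bool" where
  "estimator a b N Ghat \<longleftrightarrow>
     (\<forall>x\<in>space N. Ghat x \<in> mono_steps a b) \<and>
     (\<forall>t\<in>{a..b}. (\<lambda>x. Ghat x t) \<in> borel_measurable N)"

definition risk_bound ::
    "real \<Rightarrow> 'w measure \<Rightarrow> real \<Rightarrow> real \<Rightarrow> (real \<Rightarrow> real) \<Rightarrow> ('w \<Rightarrow> real \<Rightarrow> real) \<Rightarrow>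
     real list \<Rightarrow> ennreal" where
  "risk_bound C M a b g Z ts =
     4 * L1_setdist a b g (steps_of a b ts) +
     ennreal C * (\<Sum>k\<in>{1..<length ts}.
       \<integral>\<^sup>+w. (SUP t\<in>{ts ! (k - 1)..ts ! k}. ennreal \<bar>Z w t - Z w (ts ! (k - 1))\<bar>) \<partial>M)"

end

theory Submission
  imports Defs
begin

text \<open>
  Fix a sample, write \<open>F\<close> for the estimate, \<open>Z = F - G\<close>, \<open>\<omega> k\<close> for the supremum of
  \<open>\<bar>Z t - Z (ts ! k)\<bar>\<close> over the cell that starts at \<open>ts ! k\<close>, and \<open>\<Omega>\<close> for the sum of the \<open>\<omega> k\<close>.
  Everything rests on the inequality \<open>\<parallel>U_S F - g\<parallel> \<le> 4 \<parallel>g - h\<parallel> + 22 \<Omega>\<close> for each sample and each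
  step function \<open>h\<close> on the partition (\<open>L1_dist_U_S_le\<close>), in which 22 is less than 49; it is then
  integrated over the samples, the suprema being measurable because \<open>Z\<close> is right-continuous.

  The core is the case in which the slope \<open>\<phi>\<close> of a concave majorant \<open>\<Phi>\<close> of \<open>E\<close> and the target
  \<open>g\<close> are both nonincreasing (\<open>monotone_slope_L1_bound\<close>). On a cell with endpoints \<open>s\<close> and \<open>t\<close>
  replace \<open>g\<close> by its value \<open>c\<close> at the midpoint; \<open>c\<close> is a median of \<open>g\<close>, so no constant is closer to
  \<open>g\<close> in \<open>L\<^sub>1\<close>. Since \<open>\<phi> - c\<close> changes sign at most once, from plus to minus at some \<open>r\<close>, the
  integral of \<open>\<bar>\<phi> - c\<bar>\<close> is \<open>2 \<Phi> r - \<Phi> s - \<Phi> t\<close> up to linear terms. If \<open>\<Phi>\<close> may be replaced by \<open>E\<close>,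
  the result is controlled by the oscillation of \<open>E - G\<close> on the cell. At \<open>s\<close> and \<open>t\<close> this costs
  nothing, because \<open>\<Phi> \<ge> E\<close> enters with a minus sign. If \<open>r\<close> is interior to the cell, then \<open>\<Phi>\<close> bends at
  \<open>r\<close>, and a least concave majorant bends only where it touches \<open>E\<close>. If \<open>r\<close> is an endpoint,
  then the excess \<open>\<Phi> - E\<close> at that endpoint enters with a plus sign and is cancelled by the
  neighbouring cell, unless \<open>\<phi>\<close> lies above the median on the left of the endpoint and below the
  median on its right; as the medians decrease, \<open>\<phi>\<close> then drops at the endpoint, so \<open>\<Phi>\<close> touches
  \<open>E\<close> there and the excess is zero.

  The chosen mode \<open>\<mu>\<close> need not be the mode \<open>m\<close> of \<open>g\<close>. But \<open>\<mu>\<close> minimizes \<open>d_S\<close>, and \<open>d_S m \<le> 2 \<Omega>\<close>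
  by Marshall's inequality: \<open>G\<close> is concave before \<open>m\<close> and convex after it, so regularizing moves
  \<open>F\<close> by at most twice its distance to a translate of \<open>G\<close>. Hence the regularization with mode \<open>\<mu>\<close> is
  also within \<open>2 \<Omega>\<close> of \<open>F\<close>. Outside the interval between \<open>m\<close> and \<open>\<mu>\<close> the core estimate applies,
  with one extra boundary term of size \<open>2 \<Omega>\<close> on each side; inside it the slope and \<open>g\<close> are monotone in
  opposite directions, so their difference changes sign once, and its \<open>L\<^sub>1\<close> norm is a second
  difference of a function that stays close to a constant.

  Convex minorants are treated as negatives of concave majorants of \<open>- F\<close>. The two cases differ in
  one point: \<open>F\<close> jumps upwards, so that a concave majorant touches \<open>F\<close> itself, whereas a convex
  minorant touches the left limits of \<open>F\<close>. Passing from values to left limits at the partition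
  points adds jumps of \<open>Z\<close>, each of them at most \<open>2 \<omega> k\<close>.
\<close>

section \<open>The \<open>L\<^sub>1\<close> distance between a slope and a monotone function\<close>

lemma antimono_threshold:
  fixes \<psi> :: "real \<Rightarrow> real"
  assumes "s \<le> t" and "antimono_on {s<..<t} \<psi>"
  obtains r where "r \<in> {s..t}" "\<And>x. s < x \<Longrightarrow> x < r \<Longrightarrow> c < \<psi> x"
    "\<And>x. r < x \<Longrightarrow> x < t \<Longrightarrow> \<psi> x \<le> c"
proof
  define S where "S = insert s {x \<in> {s<..<t}. c < \<psi> x}"
  have bdd: "bdd_above S" and ne: "S \<noteq> {}"
    by (auto simp: S_def intro!: bdd_aboveI[of _ t] assms(1))
  show "Sup S \<in> {s..t}"
    using assms(1) bdd by (auto simp: S_def intro!: cSup_upper cSup_least)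
  show "c < \<psi> x" if x: "s < x" "x < Sup S" for x
  proof -
    obtain y where "y \<in> S" "x < y"
      using x(2) less_cSup_iff[OF ne bdd] by blast
    then show ?thesis
      using x monotone_onD[OF assms(2), of x y] by (auto simp: S_def)
  qed
  show "\<psi> x \<le> c" if x: "Sup S < x" "x < t" for x
  proof (rule ccontr)
    assume "\<not> \<psi> x \<le> c"
    moreover have "s \<le> Sup S"
      using bdd by (auto simp: S_def intro!: cSup_upper)
    ultimately have "x \<in> S" using x by (auto simp: S_def)
    then show False using cSup_upper[OF _ bdd] x by force
  qed
qed

text \<open>Only one sign change is possible, so the absolute integral is a second difference of the
  primitive, taken at the sign change.\<close>

lemma has_integral_abs_antimono:
  fixes \<psi> \<Psi> :: "real \<Rightarrow> real"
  assumes "s \<le> t" and "antimono_on {s<..<t} \<psi>"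
    and int: "\<And>x y. s \<le> x \<Longrightarrow> x \<le> y \<Longrightarrow> y \<le> t \<Longrightarrow> (\<psi> has_integral \<Psi> y - \<Psi> x) {x..y}"
  shows "\<exists>r\<in>{s..t}. (\<forall>x. s < x \<longrightarrow> x < r \<longrightarrow> 0 < \<psi> x) \<and>
    (\<forall>x. r < x \<longrightarrow> x < t \<longrightarrow> \<psi> x \<le> 0) \<and>
    ((\<lambda>x. \<bar>\<psi> x\<bar>) has_integral 2 * \<Psi> r - \<Psi> s - \<Psi> t) {s..t}"
proof -
  obtain r where r: "r \<in> {s..t}" "\<And>x. s < x \<Longrightarrow> x < r \<Longrightarrow> 0 < \<psi> x"
    "\<And>x. r < x \<Longrightarrow> x < t \<Longrightarrow> \<psi> x \<le> 0"
    using antimono_threshold[OF assms(1,2)] by metis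
  have "((\<lambda>x. \<bar>\<psi> x\<bar>) has_integral \<Psi> r - \<Psi> s) {s..r}"
    by (rule has_integral_spike_finite[where S="{s, r}" and f=\<psi>])
       (use r in \<open>auto intro!: int abs_of_pos\<close>)
  moreover have "((\<lambda>x. \<bar>\<psi> x\<bar>) has_integral - (\<Psi> t - \<Psi> r)) {r..t}"
    by (rule has_integral_spike_finite[where S="{r, t}" and f="\<lambda>x. - \<psi> x"])
       (use r has_integral_neg[OF int[of r t]] in \<open>auto intro!: abs_of_nonpos\<close>)
  ultimately have "((\<lambda>x. \<bar>\<psi> x\<bar>) has_integral (\<Psi> r - \<Psi> s) + - (\<Psi> t - \<Psi> r)) {s..t}"
    using r(1) by (intro has_integral_combine[where c=r]) auto
  then show ?thesis
    using r by (intro bexI[of _ r]) (auto simp: algebra_simps)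
qed

text \<open>The function may be unbounded near the ends of the interval; that its primitive extends to the
  ends makes it integrable.\<close>

lemma antimono_absolutely_integrable:
  fixes \<psi> \<Psi> :: "real \<Rightarrow> real"
  assumes "s \<le> t" and "antimono_on {s<..<t} \<psi>"
    and int: "\<And>x y. s \<le> x \<Longrightarrow> x \<le> y \<Longrightarrow> y \<le> t \<Longrightarrow> (\<psi> has_integral \<Psi> y - \<Psi> x) {x..y}"
  shows "\<psi> absolutely_integrable_on {s..t}"
proof -
  obtain I where "((\<lambda>x. \<bar>\<psi> x\<bar>) has_integral I) {s..t}"
    using has_integral_abs_antimono[OF assms] by blast
  then show ?thesis
    using int[of s t] assms(1)
    by (intro abs_absolutely_integrableI_1) (auto simp: integrable_on_def)
qed

text \<open>The midpoint value of a monotone function is a median, hence a best constant in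
  \<open>L\<^sub>1\<close>: the two halves have the same length, so changing the constant does not change
  the difference of the integrals over them.\<close>

lemma integral_abs_median_le:
  fixes g G :: "real \<Rightarrow> real"
  assumes "s \<le> t" and "antimono_on {s..t} g"
    and int: "\<And>x y. s \<le> x \<Longrightarrow> x \<le> y \<Longrightarrow> y \<le> t \<Longrightarrow> (g has_integral G y - G x) {x..y}"
  shows "integral {s..t} (\<lambda>x. \<bar>g x - g ((s + t) / 2)\<bar>) \<le> integral {s..t} (\<lambda>x. \<bar>g x - c\<bar>)"
proof -
  define q where "q = (s + t) / 2"
  have q: "s \<le> q" "q \<le> t" using assms(1) by (auto simp: q_def)
  have abs: "(\<lambda>x. g x - c') absolutely_integrable_on {x..y}"
    if "s \<le> x" "x \<le> y" "y \<le> t" for c' x y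
    using assms(2) that has_integral_diff[OF int has_integral_const_real]
    by (intro antimono_absolutely_integrable[where \<Psi>="\<lambda>x. G x - c' * x"])
       (auto simp: monotone_on_def algebra_simps)
  have abs': "(\<lambda>x. \<bar>g x - c'\<bar>) integrable_on {x..y}" if "s \<le> x" "x \<le> y" "y \<le> t" for c' x y
    using abs[OF that] by (simp add: absolutely_integrable_on_def)
  have "((\<lambda>x. g x - g q) has_integral G q - G s - g q * (q - s)) {s..q}"
    using has_integral_diff[OF int has_integral_const_real, of s q "g q"] q by (simp add: algebra_simps)
  then have "((\<lambda>x. \<bar>g x - g q\<bar>) has_integral G q - G s - g q * (q - s)) {s..q}"
    by (rule has_integral_eq[rotated]) (use q monotone_onD[OF assms(2), of _ q] in force)
  moreover have "((\<lambda>x. g q - g x) has_integral g q * (t - q) - (G t - G q)) {q..t}"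
    using has_integral_diff[OF has_integral_const_real int, of q t "g q"] q by (simp add: algebra_simps)
  then have "((\<lambda>x. \<bar>g x - g q\<bar>) has_integral g q * (t - q) - (G t - G q)) {q..t}"
    by (rule has_integral_eq[rotated]) (use q monotone_onD[OF assms(2), of q] in force)
  ultimately have "integral {s..t} (\<lambda>x. \<bar>g x - g q\<bar>)
      = G q - G s - g q * (q - s) + (g q * (t - q) - (G t - G q))"
    using has_integral_combine[OF q] by (intro integral_unique) blast
  also have "\<dots> = (G q - G s - c * (q - s)) + (c * (t - q) - (G t - G q))"
    by (simp add: q_def field_simps)
  also have "G q - G s - c * (q - s) = integral {s..q} (\<lambda>x. g x - c)"
    using has_integral_diff[OF int has_integral_const_real, of s q c] q
    by (simp add: algebra_simps integral_unique)
  also have "c * (t - q) - (G t - G q) = integral {q..t} (\<lambda>x. c - g x)"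
    using has_integral_diff[OF has_integral_const_real int, of q t c] q
    by (simp add: algebra_simps integral_unique)
  also have "integral {s..q} (\<lambda>x. g x - c) \<le> integral {s..q} (\<lambda>x. \<bar>g x - c\<bar>)"
    using abs abs' q by (intro integral_le) (auto simp: absolutely_integrable_on_def)
  also have "integral {q..t} (\<lambda>x. c - g x) \<le> integral {q..t} (\<lambda>x. \<bar>g x - c\<bar>)"
    using has_integral_diff[OF has_integral_const_real int, of q t c] abs' q
    by (intro integral_le) (auto simp: integrable_on_def)
  also have "integral {s..q} (\<lambda>x. \<bar>g x - c\<bar>) + integral {q..t} (\<lambda>x. \<bar>g x - c\<bar>)
      = integral {s..t} (\<lambda>x. \<bar>g x - c\<bar>)"
    using q abs' by (intro Henstock_Kurzweil_Integration.integral_combine) auto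
  finally show ?thesis by (simp add: q_def)
qed

text \<open>The estimate on one cell. It keeps the sign change \<open>r\<close> explicit, because the
  position of \<open>r\<close> decides how the cells interact.\<close>

lemma cell_L1_bound:
  fixes \<phi> \<Phi> g G :: "real \<Rightarrow> real"
  assumes st: "s \<le> t" and "antimono_on {s<..<t} \<phi>" and "antimono_on {s..t} g"
    and \<phi>: "\<And>x y. s \<le> x \<Longrightarrow> x \<le> y \<Longrightarrow> y \<le> t \<Longrightarrow> (\<phi> has_integral \<Phi> y - \<Phi> x) {x..y}"
    and g: "\<And>x y. s \<le> x \<Longrightarrow> x \<le> y \<Longrightarrow> y \<le> t \<Longrightarrow> (g has_integral G y - G x) {x..y}"
  obtains r where "r \<in> {s..t}" "\<And>x. s < x \<Longrightarrow> x < r \<Longrightarrow> g ((s + t) / 2) < \<phi> x"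
    "\<And>x. r < x \<Longrightarrow> x < t \<Longrightarrow> \<phi> x \<le> g ((s + t) / 2)"
    "integral {s..t} (\<lambda>x. \<bar>\<phi> x - g x\<bar>)
       \<le> 2 * (\<Phi> r - G r) - (\<Phi> s - G s) - (\<Phi> t - G t) + 2 * integral {s..t} (\<lambda>x. \<bar>g x - c\<bar>)"
proof -
  define k where "k = g ((s + t) / 2)"
  have intk: "((\<lambda>x. \<phi> x - k) has_integral (\<Phi> y - k * y) - (\<Phi> x - k * x)) {x..y}"
    if "s \<le> x" "x \<le> y" "y \<le> t" for x y
    using has_integral_diff[OF \<phi>[OF that] has_integral_const_real, of k] that
    by (simp add: algebra_simps)
  have mono: "antimono_on {s<..<t} (\<lambda>x. \<phi> x - k)"
    using assms(2) by (auto simp: monotone_on_def)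
  obtain r where r: "r \<in> {s..t}" "\<forall>x. s < x \<longrightarrow> x < r \<longrightarrow> 0 < \<phi> x - k"
    "\<forall>x. r < x \<longrightarrow> x < t \<longrightarrow> \<phi> x - k \<le> 0"
    and I: "((\<lambda>x. \<bar>\<phi> x - k\<bar>) has_integral
        2 * (\<Phi> r - k * r) - (\<Phi> s - k * s) - (\<Phi> t - k * t)) {s..t}"
    using has_integral_abs_antimono[OF st mono intk] by blast
  have gk: "((\<lambda>x. g x - k) has_integral (G y - k * y) - (G x - k * x)) {x..y}"
    if "s \<le> x" "x \<le> y" "y \<le> t" for x y
    using has_integral_diff[OF g[OF that] has_integral_const_real, of k] that
    by (simp add: algebra_simps)
  have mono': "antimono_on {s<..<t} g" "antimono_on {s<..<t} (\<lambda>x. g x - k)"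
    using assms(3) by (auto simp: monotone_on_def)
  have abs: "(\<lambda>x. g x - k) absolutely_integrable_on {s..t}"
    by (rule antimono_absolutely_integrable[OF st mono'(2) gk])
  have abs': "(\<lambda>x. \<bar>g x - k\<bar>) integrable_on {x..y}" if "s \<le> x" "y \<le> t" for x y
    using absolutely_integrable_on_subinterval[OF abs, of x y] that
    by (simp add: absolutely_integrable_on_def)
  have "(\<lambda>x. \<phi> x - g x) absolutely_integrable_on {s..t}"
    by (intro set_integral_diff antimono_absolutely_integrable[OF st _ \<phi>]
        antimono_absolutely_integrable[OF st _ g] mono' assms(2))
  then have "integral {s..t} (\<lambda>x. \<bar>\<phi> x - g x\<bar>)
      \<le> integral {s..t} (\<lambda>x. \<bar>\<phi> x - k\<bar> + \<bar>g x - k\<bar>)"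
    using abs I by (intro integral_le integrable_add)
      (auto simp: absolutely_integrable_on_def integrable_on_def)
  also have "\<dots> = (2 * (\<Phi> r - k * r) - (\<Phi> s - k * s) - (\<Phi> t - k * t))
      + integral {s..t} (\<lambda>x. \<bar>g x - k\<bar>)"
    using abs I by (subst Henstock_Kurzweil_Integration.integral_add)
      (auto simp: absolutely_integrable_on_def integral_unique)
  also have "\<dots> = 2 * (\<Phi> r - G r) - (\<Phi> s - G s) - (\<Phi> t - G t)
      + ((G r - k * r) - (G s - k * s) - ((G t - k * t) - (G r - k * r)))
      + integral {s..t} (\<lambda>x. \<bar>g x - k\<bar>)"
    by (simp add: algebra_simps)
  also have "(G r - k * r) - (G s - k * s) - ((G t - k * t) - (G r - k * r))
      \<le> integral {s..t} (\<lambda>x. \<bar>g x - k\<bar>)"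
  proof -
    have "(G r - k * r) - (G s - k * s) \<le> integral {s..r} (\<lambda>x. \<bar>g x - k\<bar>)"
      by (rule has_integral_le[OF gk integrable_integral[OF abs']]) (use r in auto)
    moreover have "- ((G t - k * t) - (G r - k * r)) \<le> integral {r..t} (\<lambda>x. \<bar>g x - k\<bar>)"
      by (rule has_integral_le[OF has_integral_neg[OF gk] integrable_integral[OF abs']])
         (use r in auto)
    moreover have "integral {s..r} (\<lambda>x. \<bar>g x - k\<bar>) + integral {r..t} (\<lambda>x. \<bar>g x - k\<bar>)
      = integral {s..t} (\<lambda>x. \<bar>g x - k\<bar>)"
      using r abs' by (intro Henstock_Kurzweil_Integration.integral_combine) auto
    ultimately show ?thesis by linarith
  qed
  also have "integral {s..t} (\<lambda>x. \<bar>g x - k\<bar>) \<le> integral {s..t} (\<lambda>x. \<bar>g x - c\<bar>)"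
    unfolding k_def by (rule integral_abs_median_le[OF st assms(3) g])
  finally show ?thesis
    using r that[of r] by (simp add: k_def)
qed

text \<open>The core estimate. Cells may be degenerate, which allows a partition of a larger
  interval to be truncated by clamping its breakpoints. The assumption \<open>touch\<close> says that
  \<open>\<Phi>\<close> meets \<open>E\<close> wherever its slope drops. The excess \<open>\<Phi> - E\<close> is allowed
  to be positive at the two ends, where it is charged to the bound.\<close>

lemma monotone_slope_L1_bound:
  fixes \<phi> \<Phi> g G E :: "real \<Rightarrow> real" and p \<beta> c :: "nat \<Rightarrow> real"
  assumes p: "\<And>k. k < D \<Longrightarrow> p k \<le> p (Suc k)"
    and \<phi>_mono: "antimono_on {p 0<..<p D} \<phi>" and g_mono: "antimono_on {p 0..p D} g"
    and \<phi>: "\<And>x y. p 0 \<le> x \<Longrightarrow> x \<le> y \<Longrightarrow> y \<le> p D \<Longrightarrow> (\<phi> has_integral \<Phi> y - \<Phi> x) {x..y}"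
    and g: "\<And>x y. p 0 \<le> x \<Longrightarrow> x \<le> y \<Longrightarrow> y \<le> p D \<Longrightarrow> (g has_integral G y - G x) {x..y}"
    and maj: "\<And>x. x \<in> {p 0..p D} \<Longrightarrow> E x \<le> \<Phi> x"
    and touch: "\<And>x d. x \<in> {p 0<..<p D} \<Longrightarrow> (\<And>y. p 0 < y \<Longrightarrow> y < x \<Longrightarrow> d < \<phi> y) \<Longrightarrow>
      (\<And>y. x < y \<Longrightarrow> y < p D \<Longrightarrow> \<phi> y \<le> d) \<Longrightarrow> \<Phi> x \<le> E x"
    and osc: "\<And>k r. k < D \<Longrightarrow> r \<in> {p k..p (Suc k)} \<Longrightarrow>
      2 * (E r - G r) - (E (p k) - G (p k)) - (E (p (Suc k)) - G (p (Suc k))) \<le> \<beta> k"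
  shows "(\<lambda>x. \<bar>\<phi> x - g x\<bar>) integrable_on {p 0..p D}"
    and "integral {p 0..p D} (\<lambda>x. \<bar>\<phi> x - g x\<bar>) \<le> (\<Phi> (p 0) - E (p 0)) + (\<Phi> (p D) - E (p D))
      + (\<Sum>k<D. \<beta> k) + 2 * (\<Sum>k<D. integral {p k..p (Suc k)} (\<lambda>x. \<bar>g x - c k\<bar>))"
proof -
  have pm: "p i \<le> p j" if "i \<le> j" "j \<le> D" for i j
    using that(2) by (induction rule: dec_induct[OF that(1)]) (use p in \<open>auto intro: order_trans\<close>)
  note p0 = pm[of 0, simplified]
  have "(\<lambda>x. \<phi> x - g x) absolutely_integrable_on {p 0..p D}"
    using p0[of D] g_mono
    by (intro set_integral_diff antimono_absolutely_integrable[OF _ _ \<phi>]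
        antimono_absolutely_integrable[OF _ _ g] \<phi>_mono) (auto simp: monotone_on_def)
  then show int: "(\<lambda>x. \<bar>\<phi> x - g x\<bar>) integrable_on {p 0..p D}"
    by (auto simp: absolutely_integrable_on_def)
  define \<Delta> where "\<Delta> x = \<Phi> x - E x" for x
  define B where "B n = \<Delta> (p 0) + (\<Sum>k<n. \<beta> k)
    + 2 * (\<Sum>k<n. integral {p k..p (Suc k)} (\<lambda>x. \<bar>g x - c k\<bar>))" for n
  define S where "S n = integral {p 0..p n} (\<lambda>x. \<bar>\<phi> x - g x\<bar>)" for n
  \<comment> \<open>Up to \<open>p n\<close> the bound either holds with the excess to spare, or it is exceeded by at most the
    excess. In the second case some \<open>d\<close> lies below all earlier slopes and above all later values
    of \<open>g\<close>; if the next cell starts with slopes below its median, the slope drops at \<open>p n\<close>, and the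
    excess is zero.\<close>
  have "S n \<le> B n - \<Delta> (p n) \<or> (S n \<le> B n + \<Delta> (p n) \<and> p 0 < p n \<and>
     (\<exists>d. (\<forall>y. p 0 < y \<longrightarrow> y < p n \<longrightarrow> d < \<phi> y) \<and> (\<forall>y. p n < y \<longrightarrow> y \<le> p D \<longrightarrow> g y \<le> d)))"
    if "n \<le> D" for n
    using that
  proof (induction n)
    case 0
    show ?case by (simp add: S_def B_def)
  next
    case (Suc n)
    let ?s = "p n" and ?t = "p (Suc n)"
    let ?q = "(?s + ?t) / 2"
    have n: "n < D" "n \<le> D" and st: "?s \<le> ?t" "p 0 \<le> ?s" "?t \<le> p D"
      using Suc.prems p pm by auto
    have \<Delta>: "0 \<le> \<Delta> ?s" "0 \<le> \<Delta> ?t"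
      using maj[of ?s] maj[of ?t] st by (auto simp: \<Delta>_def)
    obtain r where r: "r \<in> {?s..?t}" "\<And>x. ?s < x \<Longrightarrow> x < r \<Longrightarrow> g ?q < \<phi> x"
      "\<And>x. r < x \<Longrightarrow> x < ?t \<Longrightarrow> \<phi> x \<le> g ?q"
      and I: "integral {?s..?t} (\<lambda>x. \<bar>\<phi> x - g x\<bar>) \<le> 2 * (\<Phi> r - G r) - (\<Phi> ?s - G ?s)
        - (\<Phi> ?t - G ?t) + 2 * integral {?s..?t} (\<lambda>x. \<bar>g x - c n\<bar>)"
    proof (rule cell_L1_bound[of ?s ?t \<phi> g \<Phi> G "c n"])
      show "antimono_on {?s<..<?t} \<phi>" "antimono_on {?s..?t} g"
        using \<phi>_mono g_mono st by (auto simp: monotone_on_def)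
    qed (use st \<phi> g in auto)
    have "S (Suc n) = S n + integral {?s..?t} (\<lambda>x. \<bar>\<phi> x - g x\<bar>)"
      unfolding S_def using st
      by (intro Henstock_Kurzweil_Integration.integral_combine[symmetric]
          integrable_on_subinterval[OF int]) auto
    moreover have "B (Suc n) = B n + \<beta> n + 2 * integral {?s..?t} (\<lambda>x. \<bar>g x - c n\<bar>)"
      by (simp add: B_def)
    ultimately have step: "S (Suc n) - B (Suc n) \<le> S n - B n + 2 * \<Delta> r - \<Delta> ?s - \<Delta> ?t"
      using I osc[OF n(1) r(1)] unfolding \<Delta>_def by argo
    \<comment> \<open>Monotonicity of \<open>\<phi>\<close> extends one-sided bounds near \<open>r\<close> to the whole interval.\<close>
    have left: "d < \<phi> y" if "\<And>y. u < y \<Longrightarrow> y < r \<Longrightarrow> d < \<phi> y" "u < r" "r \<le> p D" "p 0 < y" "y < r" for d u y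
    proof -
      let ?z = "(max u y + r) / 2"
      have "max u y < ?z" "?z < r" using that by (auto simp: max_def)
      then show ?thesis
        using that monotone_onD[OF \<phi>_mono, of y ?z] that(1)[of ?z] by fastforce
    qed
    have right: "\<phi> y \<le> d" if "\<And>y. r < y \<Longrightarrow> y < u \<Longrightarrow> \<phi> y \<le> d" "r < u" "p 0 \<le> r" "y < p D" "r < y" for d u y
    proof -
      let ?z = "(r + min u y) / 2"
      have "r < ?z" "?z < min u y" using that by (auto simp: min_def)
      then show ?thesis
        using that monotone_onD[OF \<phi>_mono, of ?z y] that(1)[of ?z] by fastforce
    qed
    consider "?s = ?t" | "?s < ?t" "r = ?t" | "?s < r" "r < ?t" | "?s < ?t" "r = ?s"
      using r(1) by force
    then show ?case
    proof cases
      case 1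
      moreover have "r = ?s" using 1 r(1) by auto
      ultimately show ?thesis using Suc.IH[OF n(2)] step by auto
    next
      case 2
      have "S n \<le> B n + \<Delta> ?s" using Suc.IH[OF n(2)] \<Delta> by auto
      then have "S (Suc n) \<le> B (Suc n) + \<Delta> ?t" using step 2 by simp
      moreover have "g ?q < \<phi> y" if "p 0 < y" "y < ?t" for y
        using left[of ?s] r(2) 2 st that by auto
      moreover have "g y \<le> g ?q" if "?t < y" "y \<le> p D" for y
        using monotone_onD[OF g_mono, of ?q y] that 2 st by auto
      moreover have "p 0 < ?t" using 2 st by auto
      ultimately show ?thesis by blast
    next
      case 3
      have "\<Phi> r \<le> E r"
        using left[of ?s "g ?q"] right[of ?t "g ?q"] r(2,3) 3 st by (intro touch[of _ "g ?q"]) auto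
      then have "S (Suc n) \<le> B (Suc n) - \<Delta> ?t"
        using step Suc.IH[OF n(2)] \<Delta> by (auto simp: \<Delta>_def)
      then show ?thesis by blast
    next
      case 4
      from Suc.IH[OF n(2)] have "S n \<le> B n - \<Delta> ?s"
      proof
        assume *: "S n \<le> B n + \<Delta> ?s \<and> p 0 < ?s \<and>
          (\<exists>d. (\<forall>y. p 0 < y \<longrightarrow> y < ?s \<longrightarrow> d < \<phi> y) \<and> (\<forall>y. ?s < y \<longrightarrow> y \<le> p D \<longrightarrow> g y \<le> d))"
        then obtain d where d: "\<forall>y. p 0 < y \<longrightarrow> y < ?s \<longrightarrow> d < \<phi> y" "\<forall>y. ?s < y \<longrightarrow> y \<le> p D \<longrightarrow> g y \<le> d"
          by blast
        \<comment> \<open>The slope is above \<open>d\<close> before \<open>p n\<close> and below the smaller median after it.\<close>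
        have "g ?q \<le> d" using d(2) 4 st by auto
        have "\<Phi> ?s \<le> E ?s"
        proof (intro touch[of _ d])
          show "?s \<in> {p 0<..<p D}" using * 4 st by auto
          show "d < \<phi> y" if "p 0 < y" "y < ?s" for y using d(1) that by blast
          show "\<phi> y \<le> d" if "?s < y" "y < p D" for y
          proof (rule right[of ?t d y])
            show "\<phi> z \<le> d" if "r < z" "z < ?t" for z
              using r(3)[OF that] \<open>g ?q \<le> d\<close> by simp
          qed (use that 4 st in auto)
        qed
        then show ?thesis using * by (auto simp: \<Delta>_def)
      qed
      then have "S (Suc n) \<le> B (Suc n) - \<Delta> ?t" using step 4 by simp
      then show ?thesis by blast
    qed
  qed
  from this[of D] have "S D \<le> B D + \<Delta> (p D)"
    using maj[of "p D"] p0[of D] by (auto simp: \<Delta>_def)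
  then show "integral {p 0..p D} (\<lambda>x. \<bar>\<phi> x - g x\<bar>) \<le> (\<Phi> (p 0) - E (p 0)) + (\<Phi> (p D) - E (p D))
      + (\<Sum>k<D. \<beta> k) + 2 * (\<Sum>k<D. integral {p k..p (Suc k)} (\<lambda>x. \<bar>g x - c k\<bar>))"
    by (simp add: S_def B_def \<Delta>_def)
qed

section \<open>Least concave majorants of step functions\<close>

lemma lcm_le:
  assumes "concave_on S h" "\<And>s. s \<in> S \<Longrightarrow> E s \<le> h s" "t \<in> S"
  shows "least_concave_majorant S E t \<le> h t"
  unfolding least_concave_majorant_def
  by (rule cInf_lower) (use assms in \<open>auto intro!: bdd_belowI[of _ "E t"]\<close>)

lemma lcm_greatest:
  assumes "convex S" "\<And>s. s \<in> S \<Longrightarrow> E s \<le> M"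
    and "\<And>h. concave_on S h \<Longrightarrow> \<forall>s\<in>S. E s \<le> h s \<Longrightarrow> z \<le> h t"
  shows "z \<le> least_concave_majorant S E t"
  unfolding least_concave_majorant_def
proof (rule cInf_greatest)
  show "{h t |h. concave_on S h \<and> (\<forall>s\<in>S. E s \<le> h s)} \<noteq> {}"
    using assms(1,2) concave_on_const[of S M] by blast
qed (use assms(3) in auto)

lemma lcm_ge:
  assumes "convex S" "\<And>s. s \<in> S \<Longrightarrow> E s \<le> M" "t \<in> S"
  shows "E t \<le> least_concave_majorant S E t"
  by (rule lcm_greatest[OF assms(1,2)]) (use assms(3) in auto)

lemma lcm_concave:
  assumes "convex S" "\<And>s. s \<in> S \<Longrightarrow> E s \<le> M"
  shows "concave_on S (least_concave_majorant S E)"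
  unfolding concave_on_iff
proof (intro conjI ballI allI impI)
  fix x y u v :: real
  assume *: "x \<in> S" "y \<in> S" "0 \<le> u" "0 \<le> v" "u + v = 1"
  show "u * least_concave_majorant S E x + v * least_concave_majorant S E y
    \<le> least_concave_majorant S E (u *\<^sub>R x + v *\<^sub>R y)"
  proof (rule lcm_greatest[OF assms])
    fix h assume h: "concave_on S h" "\<forall>s\<in>S. E s \<le> h s"
    have "u * least_concave_majorant S E x + v * least_concave_majorant S E y \<le> u * h x + v * h y"
      using lcm_le[OF h(1), of E] h(2) * by (intro add_mono mult_left_mono) auto
    also have "\<dots> \<le> h (u *\<^sub>R x + v *\<^sub>R y)"
      using h(1) * unfolding concave_on_iff by blast
    finally show "u * least_concave_majorant S E x + v * least_concave_majorant S E y
      \<le> h (u *\<^sub>R x + v *\<^sub>R y)" .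
  qed
qed (fact assms(1))

text \<open>Minima of concave functions are the competitors that show a majorant to be too large.\<close>

lemma concave_on_min:
  fixes f g :: "real \<Rightarrow> real"
  assumes "concave_on S f" "concave_on S g"
  shows "concave_on S (\<lambda>x. min (f x) (g x))"
  unfolding concave_on_iff
proof (intro conjI ballI allI impI)
  fix x y u v :: real
  assume *: "x \<in> S" "y \<in> S" "0 \<le> u" "0 \<le> v" "u + v = 1"
  have "u * min (f x) (g x) + v * min (f y) (g y) \<le> u * f x + v * f y"
    "u * min (f x) (g x) + v * min (f y) (g y) \<le> u * g x + v * g y"
    using * by (auto intro!: add_mono mult_left_mono)
  then show "u * min (f x) (g x) + v * min (f y) (g y)
      \<le> min (f (u *\<^sub>R x + v *\<^sub>R y)) (g (u *\<^sub>R x + v *\<^sub>R y))"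
    using assms * unfolding concave_on_iff by (smt (verit))
qed (use assms in \<open>auto simp: concave_on_iff\<close>)

lemma concave_on_affine:
  fixes S :: "real set"
  shows "convex S \<Longrightarrow> concave_on S (\<lambda>x. a + k * x)"
  unfolding concave_on_iff by (auto simp: algebra_simps simp flip: distrib_left distrib_right)

lemma concave_on_three_points:
  fixes f :: "real \<Rightarrow> real"
  assumes "concave_on S f" "x \<in> S" "z \<in> S" "x \<le> y" "y \<le> z"
  shows "(z - y) * f x + (y - x) * f z \<le> (z - x) * f y"
proof (cases "x = z")
  case False
  define u where "u = (z - y) / (z - x)"
  define v where "v = (y - x) / (z - x)"
  have pos: "0 < z - x" using assms False by auto
  have uv: "(z - x) * u = z - y" "(z - x) * v = y - x" using pos by (auto simp: u_def v_def)
  have "(z - x) * (u + v) = (z - x) * 1" "(z - x) * (u * x + v * z) = (z - x) * y"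
    unfolding distrib_left mult.assoc[symmetric] uv by (simp_all add: algebra_simps)
  then have *: "0 \<le> u" "0 \<le> v" "u + v = 1" "u * x + v * z = y"
    using assms pos by (auto simp: u_def v_def)
  have "u * f x + v * f z \<le> f (u *\<^sub>R x + v *\<^sub>R z)"
    using assms * unfolding concave_on_iff by blast
  then have "(z - x) * (u * f x + v * f z) \<le> (z - x) * f y"
    using * assms by (intro mult_left_mono) auto
  moreover have "(z - x) * (u * f x + v * f z) = (z - y) * f x + (y - x) * f z"
    unfolding distrib_left mult.assoc[symmetric] uv ..
  ultimately show ?thesis by simp
qed (use assms in auto)

lemma concave_le_secant_outside:
  fixes f :: "real \<Rightarrow> real"
  assumes "concave_on S f" "p \<in> S" "q \<in> S" "z \<in> S" "p < q" "z \<le> p \<or> q \<le> z"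
    and line: "a + k * p = f p" "a + k * q = f q"
  shows "f z \<le> a + k * z"
  using assms(6)
proof
  assume "z \<le> p"
  then have "(q - p) * f z + (p - z) * (a + k * q) \<le> (q - z) * (a + k * p)"
    using concave_on_three_points[OF assms(1), of z q p] assms by auto
  then have "(q - p) * f z \<le> (q - p) * (a + k * z)"
    by (simp add: algebra_simps)
  then show ?thesis using \<open>p < q\<close> by simp
next
  assume "q \<le> z"
  then have "(z - q) * (a + k * p) + (q - p) * f z \<le> (z - p) * (a + k * q)"
    using concave_on_three_points[OF assms(1), of p z q] assms by auto
  then have "(q - p) * f z \<le> (q - p) * (a + k * z)"
    by (simp add: algebra_simps)
  then show ?thesis using \<open>p < q\<close> by simp
qed

text \<open>If a secant of the majorant still dominates \<open>E\<close> between its endpoints, the minimum of the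
  majorant and the line is a smaller concave majorant; hence the majorant is that
  secant. Both the affine pieces and the touching property come from this.\<close>

lemma lcm_eq_secant:
  fixes E :: "real \<Rightarrow> real"
  assumes "convex S" "\<And>s. s \<in> S \<Longrightarrow> E s \<le> M" "p \<in> S" "q \<in> S" "p < q"
    and line: "a + k * p = least_concave_majorant S E p" "a + k * q = least_concave_majorant S E q"
    and "\<And>z. p \<le> z \<Longrightarrow> z \<le> q \<Longrightarrow> E z \<le> a + k * z"
    and z: "p \<le> z" "z \<le> q"
  shows "least_concave_majorant S E z = a + k * z"
proof (rule antisym)
  let ?L = "least_concave_majorant S E"
  note conc = lcm_concave[where E=E, OF assms(1,2)]
  have zS: "z \<in> S"
    using mem_is_interval_1_I[of S p q z] assms(1,3,4) z by (simp add: is_interval_convex_1)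
  have "?L z \<le> min (?L z) (a + k * z)"
  proof (rule lcm_le[OF concave_on_min[OF conc concave_on_affine[OF assms(1)]] _ zS])
    fix s assume s: "s \<in> S"
    have "E s \<le> a + k * s"
    proof (cases "p \<le> s \<and> s \<le> q")
      case False
      then have "?L s \<le> a + k * s"
        using assms s by (intro concave_le_secant_outside[OF conc, where p=p and q=q]) auto
      then show ?thesis using lcm_ge[where E=E, OF assms(1,2) s] by simp
    qed (use assms in auto)
    then show "E s \<le> min (?L s) (a + k * s)"
      using lcm_ge[where E=E, OF assms(1,2) s] by simp
  qed
  then show "?L z \<le> a + k * z" by simp
  have "(q - z) * (a + k * p) + (z - p) * (a + k * q) \<le> (q - p) * ?L z"
    using concave_on_three_points[OF conc, of p q z] assms by auto
  then have "(q - p) * (a + k * z) \<le> (q - p) * ?L z"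
    by (simp add: algebra_simps)
  then show "a + k * z \<le> ?L z" using \<open>p < q\<close> by simp
qed

lemma lcm_eq_secant_const:
  fixes E :: "real \<Rightarrow> real"
  assumes "convex S" "\<And>s. s \<in> S \<Longrightarrow> E s \<le> M" "p \<in> S" "q \<in> S" "p < q"
    and E: "\<And>z. p \<le> z \<Longrightarrow> z \<le> q \<Longrightarrow> E z \<le> v"
    and v: "v \<le> least_concave_majorant S E p" "v \<le> least_concave_majorant S E q"
  shows "\<exists>a k. \<forall>z\<in>{p..q}. least_concave_majorant S E z = a + k * z"
proof -
  let ?L = "least_concave_majorant S E"
  define k where "k = (?L q - ?L p) / (q - p)"
  define a where "a = ?L p - k * p"
  have k: "k * (q - p) = ?L q - ?L p" using \<open>p < q\<close> by (simp add: k_def)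
  have line: "a + k * p = ?L p" "a + k * q = ?L q"
    using k by (auto simp: a_def right_diff_distrib)
  have "v \<le> a + k * z" if "p \<le> z" "z \<le> q" for z
  proof -
    have "(q - p) * v = (q - z) * v + (z - p) * v" by (simp add: algebra_simps)
    also have "\<dots> \<le> (q - z) * (a + k * p) + (z - p) * (a + k * q)"
      using line v that by (intro add_mono mult_left_mono) auto
    also have "\<dots> = (q - p) * (a + k * z)" by (simp add: algebra_simps)
    finally show ?thesis using \<open>p < q\<close> by simp
  qed
  then have E_le: "E z \<le> a + k * z" if "p \<le> z" "z \<le> q" for z
    using E that by (meson order_trans)
  have "least_concave_majorant S E z = a + k * z" if "z \<in> {p..q}" for z
    by (rule lcm_eq_secant[where E=E, OF assms(1-5) line E_le]) (use that in auto)
  then show ?thesis by blast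
qed

text \<open>On an interval where \<open>E\<close> is constant, every secant of the majorant dominates \<open>E\<close>.\<close>

lemma lcm_affine_on_constancy_interval:
  fixes E :: "real \<Rightarrow> real"
  assumes S: "convex S" "\<And>s. s \<in> S \<Longrightarrow> E s \<le> M" "{p<..<q} \<subseteq> S" "p < q"
    and "E constant_on {p<..<q}"
  shows "\<exists>a k. \<forall>z\<in>{p<..<q}. least_concave_majorant S E z = a + k * z"
proof -
  let ?L = "least_concave_majorant S E"
  obtain e where e: "\<And>z. p < z \<Longrightarrow> z < q \<Longrightarrow> E z = e"
    using assms(5) by (auto simp: constant_on_def)
  define x0 where "x0 = (2 * p + q) / 3"
  define y0 where "y0 = (p + 2 * q) / 3"
  have xy: "p < x0" "x0 < y0" "y0 < q" using \<open>p < q\<close> by (auto simp: x0_def y0_def)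
  define k where "k = (?L y0 - ?L x0) / (y0 - x0)"
  have "?L z = (?L x0 - k * x0) + k * z" if "z \<in> {p<..<q}" for z
  proof -
    have z: "p < z" "z < q" using that by auto
    have in_S: "min x0 z \<in> S" "max y0 z \<in> S" using S(3) xy z by (auto simp: min_def max_def)
    have e_le: "e \<le> ?L (min x0 z)" "e \<le> ?L (max y0 z)"
      using lcm_ge[where E=E, OF S(1,2) in_S(1)] lcm_ge[where E=E, OF S(1,2) in_S(2)]
        e[of "min x0 z"] e[of "max y0 z"] xy z by auto
    have lt: "min x0 z < max y0 z" using xy by auto
    have E_le: "E w \<le> e" if "min x0 z \<le> w" "w \<le> max y0 z" for w
      using e[of w] that xy z by (auto simp: min_def max_def split: if_splits)
    obtain a' k' where *: "\<forall>w\<in>{min x0 z..max y0 z}. ?L w = a' + k' * w"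
      using lcm_eq_secant_const[where E=E and v=e, OF S(1,2) in_S lt E_le e_le] by blast
    have "?L x0 = a' + k' * x0" "?L y0 = a' + k' * y0" "?L z = a' + k' * z"
      using * xy z by auto
    moreover from this have "?L y0 - ?L x0 = k' * (y0 - x0)" by (simp add: right_diff_distrib)
    then have "k = k'" using xy by (simp add: k_def)
    ultimately show ?thesis by simp
  qed
  then show ?thesis by blast
qed

text \<open>This evaluates the slope of the regularization, which is piecewise affine.\<close>

lemma vector_derivative_at_right_affine:
  fixes f :: "real \<Rightarrow> real"
  assumes "x < q" "\<And>z. x \<le> z \<Longrightarrow> z < q \<Longrightarrow> f z = f x + k * (z - x)"
  shows "vector_derivative f (at_right x) = k"
proof -
  have "((\<lambda>z. f x + k * (z - x)) has_vector_derivative k) (at x within {x..})"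
    by (auto intro!: derivative_eq_intros)
  then have "(f has_vector_derivative k) (at x within {x..})"
  proof (rule has_vector_derivative_transform_within[where d="q - x"])
    fix y assume "y \<in> {x..}" "dist y x < q - x"
    then show "f x + k * (y - x) = f y" using assms(2)[of y] by (auto simp: dist_real_def)
  qed (use assms(1) in auto)
  then have "(f has_vector_derivative k) (at_right x)"
    by (rule has_vector_derivative_within_subset) auto
  then show ?thesis
    by (rule vector_derivative_within[OF trivial_limit_at_right_real])
qed

lemma finite_avoid_right:
  fixes x B :: real
  assumes "finite T" "x < B"
  obtains q where "x < q" "q \<le> B" "{x<..<q} \<inter> T = {}"
proof
  let ?q = "Min (insert B {t \<in> T. x < t})"
  show "x < ?q" "?q \<le> B" using assms by auto
  show "{x<..<?q} \<inter> T = {}" using assms by auto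
qed

lemma finite_avoid_left:
  fixes x A :: real
  assumes "finite T" "A < x"
  obtains p where "A \<le> p" "p < x" "{p<..<x} \<inter> T = {}"
proof
  let ?p = "Max (insert A {t \<in> T. t < x})"
  show "A \<le> ?p" "?p < x" using assms by auto
  show "{?p<..<x} \<inter> T = {}" using assms by auto
qed

text \<open>The majorant \<open>L\<close> may jump at the ends of the interval. The function \<open>\<Phi>\<close> is its
  continuous extension from the open interval; it is a primitive of the slope \<open>\<phi>\<close> up to the
  ends. The upper bounds on \<open>\<Phi>\<close> at the ends and at points where \<open>\<phi>\<close> drops are phrased through
  bounds on \<open>E\<close> nearby, because \<open>\<Phi>\<close> touches the upper semicontinuous envelope of \<open>E\<close> and not
  always \<open>E\<close>.\<close>

lemma lcm_step_regularity:
  fixes A B :: real and E :: "real \<Rightarrow> real" and T :: "real set"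
  defines "L \<equiv> least_concave_majorant {A..B} E"
  assumes AB: "A < B" and T: "finite T"
    and const: "\<And>p q. A \<le> p \<Longrightarrow> p < q \<Longrightarrow> q \<le> B \<Longrightarrow> {p<..<q} \<inter> T = {} \<Longrightarrow> E constant_on {p<..<q}"
    and M: "\<And>s. s \<in> {A..B} \<Longrightarrow> E s \<le> M"
  obtains \<Phi> \<phi> where
    "\<And>x. A < x \<Longrightarrow> x < B \<Longrightarrow> \<Phi> x = L x"
    "\<And>x. A < x \<Longrightarrow> x < B \<Longrightarrow> \<exists>q. x < q \<and> q \<le> B \<and> (\<forall>z. x \<le> z \<longrightarrow> z < q \<longrightarrow> L z = L x + \<phi> x * (z - x))"
    "antimono_on {A<..<B} \<phi>"
    "\<And>x y. A \<le> x \<Longrightarrow> x \<le> y \<Longrightarrow> y \<le> B \<Longrightarrow> (\<phi> has_integral \<Phi> y - \<Phi> x) {x..y}"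
    "\<And>x d v. A < x \<Longrightarrow> x < B \<Longrightarrow> \<forall>\<^sub>F y in at_left x. d < \<phi> y \<Longrightarrow>
      \<forall>\<^sub>F y in at_right x. \<phi> y \<le> d \<Longrightarrow> \<forall>\<^sub>F y in nhds x. E y \<le> v \<Longrightarrow> \<Phi> x \<le> v"
    "\<And>v. \<forall>\<^sub>F y in at_right A. E y \<le> v \<Longrightarrow> E A \<le> v \<Longrightarrow> \<Phi> A \<le> v"
    "\<And>v. \<forall>\<^sub>F y in at_left B. E y \<le> v \<Longrightarrow> E B \<le> v \<Longrightarrow> \<Phi> B \<le> v"
    "\<And>x v. A \<le> x \<Longrightarrow> x < B \<Longrightarrow> \<forall>\<^sub>F y in at_right x. v \<le> E y \<Longrightarrow> v \<le> \<Phi> x"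
    "\<And>x v. A < x \<Longrightarrow> x \<le> B \<Longrightarrow> \<forall>\<^sub>F y in at_left x. v \<le> E y \<Longrightarrow> v \<le> \<Phi> x"
    "E B \<le> \<Phi> B"
proof -
  have conv: "convex {A..B}" by simp
  have conc: "concave_on {A..B} L" unfolding L_def by (rule lcm_concave[OF conv M])
  have maj: "E x \<le> L x" if "x \<in> {A..B}" for x
    unfolding L_def by (rule lcm_ge[OF conv M that])
  have "convex_on {A<..<B} (\<lambda>x. - L x)"
    using conc by (auto simp: concave_on_def intro: convex_on_subset)
  then have "continuous_on {A<..<B} (\<lambda>x. - L x)" by (intro convex_on_continuous) auto
  then have contL: "isCont L x" if "A < x" "x < B" for x
    using continuous_on_minus[of "{A<..<B}" "\<lambda>x. - L x"] that
    by (simp add: continuous_on_eq_continuous_at)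
  have aff: "\<exists>a k. \<forall>z. p < z \<longrightarrow> z < q \<longrightarrow> L z = a + k * z"
    if pq: "A \<le> p" "p < q" "q \<le> B" "{p<..<q} \<inter> T = {}" for p q
  proof -
    have sub: "{p<..<q} \<subseteq> {A..B}" using pq by auto
    obtain a k where "\<forall>z\<in>{p<..<q}. L z = a + k * z"
      using lcm_affine_on_constancy_interval[where E=E, OF conv M sub pq(2) const[OF pq]]
      unfolding L_def by blast
    then show ?thesis by (intro exI[of _ a] exI[of _ k]) auto
  qed
  obtain qA where qA: "A < qA" "qA \<le> B" "{A<..<qA} \<inter> T = {}"
    by (rule finite_avoid_right[OF T AB])
  then obtain aA kA where A: "\<And>z. A < z \<Longrightarrow> z < qA \<Longrightarrow> L z = aA + kA * z"
    using aff[of A qA] by auto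
  obtain qB where qB: "A \<le> qB" "qB < B" "{qB<..<B} \<inter> T = {}"
    by (rule finite_avoid_left[OF T AB])
  then obtain aB kB where B: "\<And>z. qB < z \<Longrightarrow> z < B \<Longrightarrow> L z = aB + kB * z"
    using aff[of qB B] by auto
  define \<Phi> where "\<Phi> x = (if x \<le> A then aA + kA * x else if B \<le> x then aB + kB * x else L x)" for x
  have \<Phi>: "\<Phi> x = L x" if "A < x" "x < B" for x using that by (simp add: \<Phi>_def)
  have \<Phi>R: "(\<Phi> \<longlongrightarrow> \<Phi> A) (at_right A)"
  proof (rule Lim_transform_eventually)
    show "((\<lambda>x. aA + kA * x) \<longlongrightarrow> \<Phi> A) (at_right A)"
      unfolding \<Phi>_def by (auto intro!: tendsto_eq_intros)
    show "\<forall>\<^sub>F x in at_right A. aA + kA * x = \<Phi> x"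
      using eventually_at_right_real[OF qA(1)] by eventually_elim (use A qA in \<open>auto simp: \<Phi>_def\<close>)
  qed
  have \<Phi>L: "(\<Phi> \<longlongrightarrow> \<Phi> B) (at_left B)"
  proof (rule Lim_transform_eventually)
    show "((\<lambda>x. aB + kB * x) \<longlongrightarrow> \<Phi> B) (at_left B)"
      using AB unfolding \<Phi>_def by (auto intro!: tendsto_eq_intros)
    show "\<forall>\<^sub>F x in at_left B. aB + kB * x = \<Phi> x"
      using eventually_at_left_real[OF qB(2)] by eventually_elim (use B qB in \<open>auto simp: \<Phi>_def\<close>)
  qed
  have \<Phi>I: "isCont \<Phi> x" if "A < x" "x < B" for x
  proof -
    have "\<forall>\<^sub>F y in nhds x. \<Phi> y = L y"
      using eventually_nhds_in_open[of "{A<..<B}" x] that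
      by (auto simp: \<Phi> elim: eventually_mono)
    then show ?thesis using contL[OF that] isCont_cong by blast
  qed
  have \<Phi>lim: "(\<Phi> \<longlongrightarrow> \<Phi> x) (at_right x)" if "A \<le> x" "x < B" for x
    using \<Phi>R \<Phi>I[of x] that by (cases "x = A") (auto simp: isCont_def intro: filterlim_mono at_le)
  have \<Phi>lim': "(\<Phi> \<longlongrightarrow> \<Phi> x) (at_left x)" if "A < x" "x \<le> B" for x
    using \<Phi>L \<Phi>I[of x] that by (cases "x = B") (auto simp: isCont_def intro: filterlim_mono at_le)
  have cont: "continuous_on {A..B} \<Phi>"
    unfolding continuous_on_def
  proof
    fix x assume x: "x \<in> {A..B}"
    consider "x = A" | "x = B" | "A < x" "x < B" using x by force
    then show "(\<Phi> \<longlongrightarrow> \<Phi> x) (at x within {A..B})"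
    proof cases
      case 1 then show ?thesis using \<Phi>R AB by (simp add: at_within_Icc_at_right)
    next
      case 2 then show ?thesis using \<Phi>L AB by (simp add: at_within_Icc_at_left)
    next
      case 3 show ?thesis using \<Phi>I[OF 3] unfolding isCont_def by (rule tendsto_within_subset) auto
    qed
  qed
  have "\<exists>k q. x < q \<and> q \<le> B \<and> (\<forall>z. x \<le> z \<longrightarrow> z < q \<longrightarrow> L z = L x + k * (z - x))"
    if x: "A < x" "x < B" for x
  proof -
    obtain q where q: "x < q" "q \<le> B" "{x<..<q} \<inter> T = {}"
      by (rule finite_avoid_right[OF T x(2)])
    then obtain a k where k: "\<And>z. x < z \<Longrightarrow> z < q \<Longrightarrow> L z = a + k * z"
      using aff[of x q] x by auto
    have "(L \<longlongrightarrow> L x) (at_right x)"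
      using contL[OF x] by (auto simp: isCont_def intro: filterlim_mono at_le)
    moreover have "(L \<longlongrightarrow> a + k * x) (at_right x)"
    proof (rule Lim_transform_eventually)
      show "\<forall>\<^sub>F z in at_right x. a + k * z = L z"
        using eventually_at_right_real[OF q(1)] by eventually_elim (use k in auto)
    qed (auto intro!: tendsto_eq_intros)
    ultimately have "L x = a + k * x"
      using tendsto_unique trivial_limit_at_right_real by blast
    then have "\<forall>z. x \<le> z \<longrightarrow> z < q \<longrightarrow> L z = L x + k * (z - x)"
      using k by (auto simp: algebra_simps le_less)
    then show ?thesis using q by blast
  qed
  then obtain \<phi> where \<phi>: "\<And>x. A < x \<Longrightarrow> x < B \<Longrightarrow>
      \<exists>q. x < q \<and> q \<le> B \<and> (\<forall>z. x \<le> z \<longrightarrow> z < q \<longrightarrow> L z = L x + \<phi> x * (z - x))"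
    by metis
  have \<phi>_eq: "\<phi> x = k"
    if xy: "A < x" "x < y" "y \<le> B" and L: "\<And>z. x \<le> z \<Longrightarrow> z < y \<Longrightarrow> L z = a + k * z" for x y a k
  proof -
    have "x < B" using xy by simp
    then obtain q where q: "x < q" "q \<le> B" "\<forall>z. x \<le> z \<longrightarrow> z < q \<longrightarrow> L z = L x + \<phi> x * (z - x)"
      using \<phi>[OF xy(1)] by blast
    define z where "z = (x + min q y) / 2"
    have z: "x < z" "z < q" "z < y" using xy q by (auto simp: z_def min_def)
    have "L z = L x + \<phi> x * (z - x)" using q(3) z by (meson less_imp_le)
    then have "a + k * z = a + k * x + \<phi> x * (z - x)"
      using L[of z] L[of x] z xy by auto
    then have "(k - \<phi> x) * (z - x) = 0" by (simp add: algebra_simps)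
    then show ?thesis using z by auto
  qed
  \<comment> \<open>The right slopes are supergradients, hence nonincreasing.\<close>
  have super: "L z \<le> L x + \<phi> x * (z - x)" if x: "A < x" "x < B" and z: "z \<in> {A..B}" for x z
  proof -
    obtain q where q: "x < q" "q \<le> B" "\<forall>z. x \<le> z \<longrightarrow> z < q \<longrightarrow> L z = L x + \<phi> x * (z - x)"
      using \<phi>[OF x] by blast
    define y where "y = (x + q) / 2"
    have y: "x < y" "y < q" using q by (auto simp: y_def)
    consider "x \<le> z" "z < q" | "z \<le> x \<or> y \<le> z" using y by force
    then show ?thesis
    proof cases
      case 1
      then have "L z = L x + \<phi> x * (z - x)" using q(3) by blast
      then show ?thesis by simp
    next
      case 2
      have "L y = L x + \<phi> x * (y - x)" using q(3) y by (meson less_imp_le)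
      then have "L z \<le> (L x - \<phi> x * x) + \<phi> x * z"
        using concave_le_secant_outside[OF conc, of x y z "L x - \<phi> x * x" "\<phi> x"] q(1,2) y x z 2
        by (auto simp: algebra_simps)
      then show ?thesis by (simp add: algebra_simps)
    qed
  qed
  have anti: "antimono_on {A<..<B} \<phi>"
  proof (rule monotone_onI)
    fix x y assume xy: "x \<in> {A<..<B}" "y \<in> {A<..<B}" "x \<le> y"
    have "0 \<le> (\<phi> x - \<phi> y) * (y - x)"
      using super[of x y] super[of y x] xy by (auto simp: algebra_simps)
    then show "\<phi> y \<le> \<phi> x" using xy by (cases "x = y") (auto simp: zero_le_mult_iff)
  qed
  have int: "(\<phi> has_integral \<Phi> y - \<Phi> x) {x..y}" if xy: "A \<le> x" "x \<le> y" "y \<le> B" for x y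
  proof (rule fundamental_theorem_of_calculus_interior_strong[OF T xy(2)])
    show "continuous_on {x..y} \<Phi>" by (rule continuous_on_subset[OF cont]) (use xy in auto)
    fix z assume z: "z \<in> {x<..<y} - T"
    then have z': "A < z" "z < B" using xy by auto
    obtain p where p: "A \<le> p" "p < z" "{p<..<z} \<inter> T = {}"
      by (rule finite_avoid_left[OF T z'(1)])
    obtain q where q: "z < q" "q \<le> B" "{z<..<q} \<inter> T = {}"
      by (rule finite_avoid_right[OF T z'(2)])
    have "{p<..<q} \<inter> T = {}" using z p q by (auto simp: set_eq_iff) (metis linorder_neqE_linordered_idom)
    then obtain a k where k: "\<And>w. p < w \<Longrightarrow> w < q \<Longrightarrow> L w = a + k * w"
      using aff[of p q] p q by auto
    have "\<phi> z = k" using k p q z' by (intro \<phi>_eq[where y=q and a=a]) auto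
    moreover have "((\<lambda>w. a + k * w) has_vector_derivative k) (at z)"
      by (auto intro!: derivative_eq_intros)
    then have "(\<Phi> has_vector_derivative k) (at z)"
      by (rule has_vector_derivative_transform_within_open[where S="{p<..<q}"])
         (use p q k in \<open>auto simp: \<Phi>\<close>)
    ultimately show "(\<Phi> has_vector_derivative \<phi> z) (at z)" by simp
  qed
  have touch: "\<Phi> x \<le> v" if x: "A < x" "x < B" and l: "\<forall>\<^sub>F y in at_left x. d < \<phi> y"
    and r: "\<forall>\<^sub>F y in at_right x. \<phi> y \<le> d" and ev: "\<forall>\<^sub>F y in nhds x. E y \<le> v" for x d v
  proof (rule ccontr)
    assume "\<not> \<Phi> x \<le> v"
    then have "v < L x" using x by (simp add: \<Phi>)
    then have "\<forall>\<^sub>F y in nhds x. v < L y"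
      using contL[OF x] by (metis isCont_def order_tendstoD(1) tendsto_at_iff_tendsto_nhds)
    moreover have "\<forall>\<^sub>F y in nhds x. y \<in> {A<..<B}" using x by (intro eventually_nhds_in_open) auto
    ultimately have "\<forall>\<^sub>F y in nhds x. v < L y \<and> E y \<le> v \<and> y \<in> {A<..<B}"
      using ev by eventually_elim auto
    then obtain e where e: "0 < e" "\<And>y. dist y x < e \<Longrightarrow> v < L y \<and> E y \<le> v \<and> y \<in> {A<..<B}"
      unfolding eventually_nhds_metric by blast
    define w where "w = x - e / 2"
    define y where "y = x + e / 2"
    have wy: "v < L z \<and> E z \<le> v \<and> z \<in> {A<..<B}" if "w \<le> z" "z \<le> y" for z
      using e(1) that by (intro e(2)) (auto simp: dist_real_def w_def y_def)
    have "w < x" "x < y" using e by (auto simp: w_def y_def)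
    then have in_AB: "w \<in> {A..B}" "y \<in> {A..B}" "w < y" using wy[of w] wy[of y] by auto
    have E_le: "\<And>z. w \<le> z \<Longrightarrow> z \<le> y \<Longrightarrow> E z \<le> v" using wy by blast
    have v_le: "v \<le> least_concave_majorant {A..B} E w" "v \<le> least_concave_majorant {A..B} E y"
      using wy[of w] wy[of y] \<open>w < x\<close> \<open>x < y\<close> by (auto simp: L_def)
    obtain a k where k: "\<And>z. w \<le> z \<Longrightarrow> z \<le> y \<Longrightarrow> L z = a + k * z"
      using lcm_eq_secant_const[where E=E and v=v and p=w and q=y, OF conv M in_AB E_le v_le]
      by (auto simp: L_def)
    have slope: "\<phi> z = k" if "w \<le> z" "z < y" for z
      using k in_AB wy[of w] that by (intro \<phi>_eq[of z y a k]) auto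
    have "\<forall>\<^sub>F z in at_left x. d < k"
      using l eventually_at_left_real[OF \<open>w < x\<close>] by eventually_elim (use slope \<open>x < y\<close> in force)
    moreover have "\<forall>\<^sub>F z in at_right x. k \<le> d"
      using r eventually_at_right_real[OF \<open>x < y\<close>] by eventually_elim (use slope \<open>w < x\<close> in force)
    ultimately show False
      by (simp add: eventually_const trivial_limit_at_left_real trivial_limit_at_right_real)
  qed
  have endA: "\<Phi> A \<le> v" if ev: "\<forall>\<^sub>F y in at_right A. E y \<le> v" and "E A \<le> v" for v
  proof -
    obtain q where q: "A < q" "\<And>y. A < y \<Longrightarrow> y < q \<Longrightarrow> E y \<le> v"
      using ev unfolding eventually_at_right_field by blast
    \<comment> \<open>The line of slope \<open>K\<close> through \<open>(A, v)\<close> dominates \<open>E\<close>: it stays above \<open>v\<close> and has reached \<open>M\<close>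
      where the bound by \<open>v\<close> ends.\<close>
    define K where "K = max 0 ((M - v) / (q - A))"
    have le: "E s \<le> (v - K * A) + K * s" if s: "s \<in> {A..B}" for s
    proof (cases "s < q")
      case True
      have "0 \<le> K * (s - A)" using s by (simp add: K_def)
      then show ?thesis using q(2)[of s] \<open>E A \<le> v\<close> s True by (cases "s = A") (auto simp: algebra_simps)
    next
      case False
      have "M - v = (M - v) / (q - A) * (q - A)" using q by simp
      also have "\<dots> \<le> K * (q - A)" using q by (intro mult_right_mono) (auto simp: K_def)
      also have "\<dots> \<le> K * (s - A)" using False by (intro mult_left_mono) (auto simp: K_def)
      finally show ?thesis using M[OF s] by (simp add: algebra_simps)
    qed
    have "\<Phi> x \<le> (v - K * A) + K * x" if "A < x" "x < B" for x
      using lcm_le[OF concave_on_affine[OF conv] le, of x] that by (simp add: \<Phi> L_def)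
    then have "\<forall>\<^sub>F x in at_right A. \<Phi> x \<le> (v - K * A) + K * x"
      using eventually_at_right_real[OF AB] by (auto elim: eventually_mono)
    moreover have "((\<lambda>x. (v - K * A) + K * x) \<longlongrightarrow> v) (at_right A)"
      by (auto intro!: tendsto_eq_intros)
    ultimately show ?thesis
      using \<Phi>R by (intro tendsto_le[of "at_right A"]) auto
  qed
  have endB: "\<Phi> B \<le> v" if ev: "\<forall>\<^sub>F y in at_left B. E y \<le> v" and "E B \<le> v" for v
  proof -
    obtain q where q: "q < B" "\<And>y. q < y \<Longrightarrow> y < B \<Longrightarrow> E y \<le> v"
      using ev unfolding eventually_at_left_field by blast
    define K where "K = max 0 ((M - v) / (B - q))"
    have le: "E s \<le> (v + K * B) + (- K) * s" if s: "s \<in> {A..B}" for s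
    proof (cases "q < s")
      case True
      have "0 \<le> K * (B - s)" using s by (simp add: K_def)
      then show ?thesis using q(2)[of s] \<open>E B \<le> v\<close> s True by (cases "s = B") (auto simp: algebra_simps)
    next
      case False
      have "M - v = (M - v) / (B - q) * (B - q)" using q by simp
      also have "\<dots> \<le> K * (B - q)" using q by (intro mult_right_mono) (auto simp: K_def)
      also have "\<dots> \<le> K * (B - s)" using False by (intro mult_left_mono) (auto simp: K_def)
      finally show ?thesis using M[OF s] by (simp add: algebra_simps)
    qed
    have "\<Phi> x \<le> (v + K * B) + (- K) * x" if "A < x" "x < B" for x
      using lcm_le[OF concave_on_affine[OF conv] le, of x] that by (simp add: \<Phi> L_def)
    then have "\<forall>\<^sub>F x in at_left B. \<Phi> x \<le> (v + K * B) + (- K) * x"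
      using eventually_at_left_real[OF AB] by (auto elim: eventually_mono)
    moreover have "((\<lambda>x. (v + K * B) + (- K) * x) \<longlongrightarrow> v) (at_left B)"
      by (auto intro!: tendsto_eq_intros)
    ultimately show ?thesis
      using \<Phi>L by (intro tendsto_le[of "at_left B"]) auto
  qed
  have lowR: "v \<le> \<Phi> x" if "A \<le> x" "x < B" "\<forall>\<^sub>F y in at_right x. v \<le> E y" for x v
  proof -
    have "\<forall>\<^sub>F y in at_right x. v \<le> \<Phi> y"
      using that(3) eventually_at_right_real[OF that(2)]
    proof eventually_elim
      case (elim y) then show ?case using maj[of y] \<Phi>[of y] that by auto
    qed
    then show ?thesis using \<Phi>lim[OF that(1,2)] by (intro tendsto_lowerbound) auto
  qed
  have lowL: "v \<le> \<Phi> x" if "A < x" "x \<le> B" "\<forall>\<^sub>F y in at_left x. v \<le> E y" for x v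
  proof -
    have "\<forall>\<^sub>F y in at_left x. v \<le> \<Phi> y"
      using that(3) eventually_at_left_real[OF that(1)]
    proof eventually_elim
      case (elim y) then show ?case using maj[of y] \<Phi>[of y] that by auto
    qed
    then show ?thesis using \<Phi>lim'[OF that(1,2)] by (intro tendsto_lowerbound) auto
  qed
  have "L B \<le> \<Phi> B"
  proof (rule tendsto_le[OF _ \<Phi>L])
    show "((\<lambda>x. ((B - x) * L A + (x - A) * L B) / (B - A)) \<longlongrightarrow> L B) (at_left B)"
      using AB by (auto intro!: tendsto_eq_intros)
    show "\<forall>\<^sub>F x in at_left B. ((B - x) * L A + (x - A) * L B) / (B - A) \<le> \<Phi> x"
      using eventually_at_left_real[OF AB]
    proof eventually_elim
      case (elim x)
      then show ?case
        using concave_on_three_points[OF conc, of A B x] AB \<Phi>[of x] by (auto simp: field_simps)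
    qed
  qed auto
  then have "E B \<le> \<Phi> B" using maj[of B] AB by auto
  from this show ?thesis
    by (intro that[OF \<Phi> \<phi> anti int touch endA endB lowR lowL])
qed

section \<open>The distance between a step function and its regularization\<close>

lemma gcm_eq_neg_lcm:
  "greatest_convex_minorant S F t = - least_concave_majorant S (\<lambda>x. - F x) t"
proof -
  have "{h t |h. convex_on S h \<and> (\<forall>s\<in>S. h s \<le> F s)}
      = uminus ` {h t |h. concave_on S h \<and> (\<forall>s\<in>S. - F s \<le> h s)}" (is "?A = uminus ` ?B")
  proof (intro equalityI subsetI)
    fix y assume "y \<in> ?A"
    then obtain h where h: "y = h t" "convex_on S h" "\<forall>s\<in>S. h s \<le> F s" by blast
    then show "y \<in> uminus ` ?B"
      by (intro image_eqI[of _ _ "- y"] CollectI exI[of _ "\<lambda>x. - h x"]) (auto simp: concave_on_def)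
  next
    fix y assume "y \<in> uminus ` ?B"
    then obtain h where "y = - h t" "concave_on S h" "\<forall>s\<in>S. - F s \<le> h s" by blast
    then show "y \<in> ?A"
      by (intro CollectI exI[of _ "\<lambda>x. - h x"]) (force simp: concave_on_def)
  qed
  then show ?thesis
    by (simp add: greatest_convex_minorant_def least_concave_majorant_def Inf_real_def)
qed

lemma lcm_mono_domain:
  fixes E :: "real \<Rightarrow> real"
  assumes "S \<subseteq> S'" "convex S" "convex S'" "\<And>s. s \<in> S' \<Longrightarrow> E s \<le> M" "t \<in> S"
  shows "least_concave_majorant S E t \<le> least_concave_majorant S' E t"
proof (rule lcm_greatest[where E=E and M=M, OF assms(3,4)])
  fix h assume h: "concave_on S' h" "\<forall>s\<in>S'. E s \<le> h s"
  have "concave_on S h"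
    using h(1) assms(1,2) by (auto simp: concave_on_def intro: convex_on_subset)
  then show "least_concave_majorant S E t \<le> h t"
    by (rule lcm_le) (use h assms in auto)
qed

text \<open>A concave function that is maximal at its right end is nondecreasing, so it may be continued by
  a constant.\<close>

lemma concave_on_extend_right:
  fixes f :: "real \<Rightarrow> real"
  assumes f: "concave_on {a..m} f" and max: "\<And>x. x \<in> {a..m} \<Longrightarrow> f x \<le> f m" and "a \<le> m"
  shows "concave_on {a..} (\<lambda>x. f (min x m))"
  unfolding concave_on_iff
proof (intro conjI ballI allI impI)
  have mono: "f x \<le> f y" if "a \<le> x" "x \<le> y" "y \<le> m" for x y
  proof (cases "x = m")
    case False
    have "(m - y) * f x + (y - x) * f x \<le> (m - y) * f x + (y - x) * f m"
      using max[of x] that by (intro add_mono mult_left_mono) auto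
    also have "\<dots> \<le> (m - x) * f y"
      using concave_on_three_points[OF f, of x m y] that by auto
    finally have "(m - x) * f x \<le> (m - x) * f y" by (simp add: algebra_simps)
    then show ?thesis using False that by auto
  qed (use that in auto)
  fix x y u v :: real
  assume *: "x \<in> {a..}" "y \<in> {a..}" "0 \<le> u" "0 \<le> v" "u + v = 1"
  have "u * a + v * a \<le> u * min x m + v * min y m"
    using * assms(3) by (intro add_mono mult_left_mono) auto
  then have ge: "a \<le> u * min x m + v * min y m"
    using * by (simp flip: distrib_right)
  have "u * min x m + v * min y m \<le> u * x + v * y"
    using * by (intro add_mono mult_left_mono) auto
  moreover have "u * min x m + v * min y m \<le> u * m + v * m"
    using * by (intro add_mono mult_left_mono) auto
  ultimately have le: "u * min x m + v * min y m \<le> min (u * x + v * y) m"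
    using * by (simp flip: distrib_right)
  have "u * f (min x m) + v * f (min y m) \<le> f (u *\<^sub>R min x m + v *\<^sub>R min y m)"
    using f * assms(3) unfolding concave_on_iff by auto
  also have "\<dots> \<le> f (min (u * x + v * y) m)"
    using mono ge le by simp
  finally show "u * f (min x m) + v * f (min y m) \<le> f (min (u *\<^sub>R x + v *\<^sub>R y) m)" by simp
qed simp

lemma concave_on_extend_left:
  fixes f :: "real \<Rightarrow> real"
  assumes f: "concave_on {m..b} f" and max: "\<And>x. x \<in> {m..b} \<Longrightarrow> f x \<le> f m" and "m \<le> b"
  shows "concave_on {..b} (\<lambda>x. f (max x m))"
proof -
  have "concave_on {- b..- m} (\<lambda>x. f (- x))"
    unfolding concave_on_iff
  proof (intro conjI ballI allI impI)
    fix x y u v :: real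
    assume "x \<in> {- b..- m}" "y \<in> {- b..- m}" "0 \<le> u" "0 \<le> v" "u + v = 1"
    then have "u * f (- x) + v * f (- y) \<le> f (u *\<^sub>R (- x) + v *\<^sub>R (- y))"
      using f[unfolded concave_on_iff, THEN conjunct2, rule_format, of "- x" "- y" u v] by auto
    then show "u * f (- x) + v * f (- y) \<le> f (- (u *\<^sub>R x + v *\<^sub>R y))" by simp
  qed simp
  then have *: "concave_on {- b..} (\<lambda>x. f (- min x (- m)))"
    using max assms(3) by (intro concave_on_extend_right) auto
  show ?thesis
    unfolding concave_on_iff
  proof (intro conjI ballI allI impI)
    fix x y u v :: real
    assume "x \<in> {..b}" "y \<in> {..b}" "0 \<le> u" "0 \<le> v" "u + v = 1"
    then have "u * f (- min (- x) (- m)) + v * f (- min (- y) (- m))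
        \<le> f (- min (u *\<^sub>R (- x) + v *\<^sub>R (- y)) (- m))"
      using *[unfolded concave_on_iff, THEN conjunct2, rule_format, of "- x" "- y" u v] by auto
    moreover have "- min (- z) (- m) = max z m" for z by auto
    moreover have "- min (u *\<^sub>R (- x) + v *\<^sub>R (- y)) (- m) = max (u *\<^sub>R x + v *\<^sub>R y) m" by auto
    ultimately show "u * f (max x m) + v * f (max y m) \<le> f (max (u *\<^sub>R x + v *\<^sub>R y) m)"
      by simp
  qed simp
qed

text \<open>Lengthening the interval to the right does not change the majorant if \<open>E\<close> does not rise
  above \<open>E m\<close>: the old majorant, continued by a constant, is a competitor.\<close>

lemma lcm_restrict_right:
  fixes E :: "real \<Rightarrow> real"
  assumes "a \<le> m" "m \<le> m'" "\<And>x. x \<in> {a..m'} \<Longrightarrow> E x \<le> E m" "t \<in> {a..m}"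
  shows "least_concave_majorant {a..m'} E t \<le> least_concave_majorant {a..m} E t"
proof -
  let ?L = "least_concave_majorant {a..m} E"
  have conv: "convex {a..m}" by simp
  have bd: "\<And>x. x \<in> {a..m} \<Longrightarrow> E x \<le> E m" using assms by auto
  note ge = lcm_ge[where E=E, OF conv bd]
  have le: "?L x \<le> E m" if "x \<in> {a..m}" for x
    using lcm_le[of "{a..m}" "\<lambda>_. E m" E, OF _ bd that] by (simp add: concave_on_const)
  have "concave_on {a..} (\<lambda>x. ?L (min x m))"
  proof (rule concave_on_extend_right[OF lcm_concave[where E=E, OF conv bd]])
    show "?L x \<le> ?L m" if "x \<in> {a..m}" for x
      using le[OF that] ge[of m] assms by auto
  qed (use assms in auto)
  then have "concave_on {a..m'} (\<lambda>x. ?L (min x m))"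
    by (auto simp: concave_on_def intro: convex_on_subset)
  then have "least_concave_majorant {a..m'} E t \<le> ?L (min t m)"
  proof (rule lcm_le)
    fix x assume x: "x \<in> {a..m'}"
    show "E x \<le> ?L (min x m)"
      using ge[of x] ge[of m] assms(1) assms(3)[OF x] x by (cases "x \<le> m") (auto simp: min_def)
  qed (use assms in auto)
  then show ?thesis using assms(4) by (simp add: min.absorb1)
qed

lemma lcm_restrict_left:
  fixes E :: "real \<Rightarrow> real"
  assumes "m' \<le> m" "m \<le> b" "\<And>x. x \<in> {m'..b} \<Longrightarrow> E x \<le> E m" "t \<in> {m..b}"
  shows "least_concave_majorant {m'..b} E t \<le> least_concave_majorant {m..b} E t"
proof -
  let ?L = "least_concave_majorant {m..b} E"
  have conv: "convex {m..b}" by simp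
  have bd: "\<And>x. x \<in> {m..b} \<Longrightarrow> E x \<le> E m" using assms by auto
  note ge = lcm_ge[where E=E, OF conv bd]
  have le: "?L x \<le> E m" if "x \<in> {m..b}" for x
    using lcm_le[of "{m..b}" "\<lambda>_. E m" E, OF _ bd that] by (simp add: concave_on_const)
  have "concave_on {..b} (\<lambda>x. ?L (max x m))"
  proof (rule concave_on_extend_left[OF lcm_concave[where E=E, OF conv bd]])
    show "?L x \<le> ?L m" if "x \<in> {m..b}" for x
      using le[OF that] ge[of m] assms by auto
  qed (use assms in auto)
  then have "concave_on {m'..b} (\<lambda>x. ?L (max x m))"
    by (auto simp: concave_on_def intro: convex_on_subset)
  then have "least_concave_majorant {m'..b} E t \<le> ?L (max t m)"
  proof (rule lcm_le)
    fix x assume x: "x \<in> {m'..b}"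
    show "E x \<le> ?L (max x m)"
      using ge[of x] ge[of m] assms(2) assms(3)[OF x] x by (cases "m \<le> x") (auto simp: max_def)
  qed (use assms in auto)
  then show ?thesis using assms(4) by (simp add: max.absorb1)
qed

lemma U_reg_bounds:
  assumes F: "mono_on {a..b} F" and m: "m \<in> {a..b}"
  shows "t \<in> {a..m} \<Longrightarrow> F t \<le> U_reg a b m F t" "t \<in> {a..m} \<Longrightarrow> U_reg a b m F t \<le> F m"
    "t \<in> {m<..b} \<Longrightarrow> F m \<le> U_reg a b m F t" "t \<in> {m<..b} \<Longrightarrow> U_reg a b m F t \<le> F t"
proof -
  have le: "\<And>x. x \<in> {a..m} \<Longrightarrow> F x \<le> F m"
    using m by (auto intro!: mono_onD[OF F])
  have ge: "\<And>x. x \<in> {m..b} \<Longrightarrow> - F x \<le> - F m"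
    using m by (auto intro!: mono_onD[OF F])
  { assume t: "t \<in> {a..m}"
    show "F t \<le> U_reg a b m F t"
      using lcm_ge[where E=F, OF convex_real_interval(5) le t] t by (simp add: U_reg_def)
    show "U_reg a b m F t \<le> F m"
      using lcm_le[of "{a..m}" "\<lambda>_. F m" F, OF _ le t] t by (simp add: U_reg_def concave_on_const) }
  { assume t: "t \<in> {m<..b}"
    then have t': "t \<in> {m..b}" by auto
    show "F m \<le> U_reg a b m F t"
      using lcm_le[of "{m..b}" "\<lambda>_. - F m" "\<lambda>x. - F x", OF _ ge t'] t
      by (simp add: U_reg_def concave_on_const gcm_eq_neg_lcm)
    show "U_reg a b m F t \<le> F t"
      using lcm_ge[where E="\<lambda>x. - F x", OF convex_real_interval(5) ge t'] t
      by (simp add: U_reg_def gcm_eq_neg_lcm) }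
qed

lemma d_S_upper:
  assumes F: "mono_on {a..b} F" and m: "m \<in> {a..b}" and t: "t \<in> {a..b}"
  shows "\<bar>F t - U_reg a b m F t\<bar> \<le> d_S a b F m"
  unfolding d_S_def
proof (rule cSUP_upper[OF t])
  show "bdd_above ((\<lambda>t. \<bar>F t - U_reg a b m F t\<bar>) ` {a..b})"
  proof (rule bdd_aboveI2)
    fix x assume x: "x \<in> {a..b}"
    have "F a \<le> F x" "F x \<le> F b" "F a \<le> F m" "F m \<le> F b"
      using m x by (auto intro!: mono_onD[OF F])
    then show "\<bar>F x - U_reg a b m F x\<bar> \<le> F b - F a"
      using U_reg_bounds[OF F m, of x] x by (cases "x \<le> m") auto
  qed
qed

lemma d_S_leI:
  assumes F: "mono_on {a..b} F" and m: "m \<in> {a..b}"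
    and "\<And>t. t \<in> {a..m} \<Longrightarrow> U_reg a b m F t \<le> F t + c"
    and "\<And>t. t \<in> {m<..b} \<Longrightarrow> F t \<le> U_reg a b m F t + c"
  shows "d_S a b F m \<le> c"
  unfolding d_S_def
proof (rule cSUP_least)
  fix t assume t: "t \<in> {a..b}"
  show "\<bar>F t - U_reg a b m F t\<bar> \<le> c"
    using U_reg_bounds[OF F m, of t] assms(3,4)[of t] t by (cases "t \<le> m") auto
qed (use m in auto)

lemma d_S_nonneg:
  assumes "mono_on {a..b} F" "m \<in> {a..b}"
  shows "0 \<le> d_S a b F m"
  using d_S_upper[OF assms assms(2)] by simp

text \<open>Moving the mode to the right enlarges the domain of the concave majorant and shrinks that of the
  convex minorant; both raise the regularization.\<close>

lemma U_reg_mono_mode: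
  assumes F: "mono_on {a..b} F" and m: "a \<le> m" "m \<le> m'" "m' \<le> b"
  shows "t \<in> {a..m} \<Longrightarrow> U_reg a b m F t \<le> U_reg a b m' F t"
    "t \<in> {m'<..b} \<Longrightarrow> U_reg a b m F t \<le> U_reg a b m' F t"
proof -
  assume t: "t \<in> {a..m}"
  have "least_concave_majorant {a..m} F t \<le> least_concave_majorant {a..m'} F t"
    by (rule lcm_mono_domain[where E=F and M="F m'"])
      (use m t in \<open>auto intro!: mono_onD[OF F]\<close>)
  then show "U_reg a b m F t \<le> U_reg a b m' F t" using t m by (simp add: U_reg_def)
next
  assume t: "t \<in> {m'<..b}"
  have "least_concave_majorant {m'..b} (\<lambda>x. - F x) t \<le> least_concave_majorant {m..b} (\<lambda>x. - F x) t"
    by (rule lcm_mono_domain[where E="\<lambda>x. - F x" and M="- F m"])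
      (use m t in \<open>auto intro!: mono_onD[OF F]\<close>)
  then show "U_reg a b m F t \<le> U_reg a b m' F t"
    using t m by (simp add: U_reg_def gcm_eq_neg_lcm)
qed

text \<open>The part of \<open>d_S\<close> left of the mode is nondecreasing in the mode and the part right of it is
  nonincreasing. Therefore the minimizers form an interval.\<close>

lemma d_S_quasiconvex:
  assumes F: "mono_on {a..b} F" and m: "a \<le> m1" "m1 \<le> m" "m \<le> m2" "m2 \<le> b"
  shows "d_S a b F m \<le> max (d_S a b F m1) (d_S a b F m2)"
proof (rule d_S_leI[OF F])
  fix t assume t: "t \<in> {a..m}"
  then show "U_reg a b m F t \<le> F t + max (d_S a b F m1) (d_S a b F m2)"
    using U_reg_mono_mode(1)[OF F, of m m2 t] d_S_upper[OF F, of m2 t] m by auto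
next
  fix t assume t: "t \<in> {m<..b}"
  then show "F t \<le> U_reg a b m F t + max (d_S a b F m1) (d_S a b F m2)"
    using U_reg_mono_mode(2)[OF F, of m1 m t] d_S_upper[OF F, of m1 t] m by auto
qed (use m in auto)

text \<open>As a function of the mode, \<open>d_S\<close> factors through \<open>F\<close> and takes finitely many values for a step
  function. Therefore the minimum is attained.\<close>

lemma d_S_cong:
  assumes F: "mono_on {a..b} F" and m: "a \<le> m" "m \<le> m'" "m' \<le> b" and eq: "F m = F m'"
  shows "d_S a b F m = d_S a b F m'"
proof (rule antisym)
  have const: "F t = F m" if "t \<in> {m..m'}" for t
    using mono_onD[OF F, of m t] mono_onD[OF F, of t m'] that m eq by auto
  have nonneg: "0 \<le> d_S a b F m" "0 \<le> d_S a b F m'"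
    using m by (auto intro!: d_S_nonneg[OF F])
  have mono: "x \<in> {a..b} \<Longrightarrow> y \<in> {a..b} \<Longrightarrow> x \<le> y \<Longrightarrow> F x \<le> F y" for x y
    by (rule mono_onD[OF F])
  show "d_S a b F m \<le> d_S a b F m'"
  proof (rule d_S_leI[OF F])
    fix t assume t: "t \<in> {a..m}"
    then show "U_reg a b m F t \<le> F t + d_S a b F m'"
      using U_reg_mono_mode(1)[OF F m t] d_S_upper[OF F, of m' t] m by auto
  next
    fix t assume t: "t \<in> {m<..b}"
    show "F t \<le> U_reg a b m F t + d_S a b F m'"
    proof (cases "t \<le> m'")
      case True
      then show ?thesis
        using const[of t] U_reg_bounds(3)[OF F, of m t] t m nonneg by auto
    next
      case False
      have "least_concave_majorant {m..b} (\<lambda>x. - F x) t \<le> least_concave_majorant {m'..b} (\<lambda>x. - F x) t"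
        by (rule lcm_restrict_left) (use m False t eq in \<open>auto intro!: mono simp flip: eq\<close>)
      then have "U_reg a b m' F t \<le> U_reg a b m F t"
        using t False by (simp add: U_reg_def gcm_eq_neg_lcm)
      then show ?thesis using d_S_upper[OF F, of m' t] m t by auto
    qed
  qed (use m in auto)
  show "d_S a b F m' \<le> d_S a b F m"
  proof (rule d_S_leI[OF F])
    fix t assume t: "t \<in> {a..m'}"
    show "U_reg a b m' F t \<le> F t + d_S a b F m"
    proof (cases "t \<le> m")
      case True
      have "least_concave_majorant {a..m'} F t \<le> least_concave_majorant {a..m} F t"
        by (rule lcm_restrict_right) (use m True t eq in \<open>auto intro!: mono\<close>)
      then have "U_reg a b m' F t \<le> U_reg a b m F t"
        using t True m by (simp add: U_reg_def)
      then show ?thesis using d_S_upper[OF F, of m t] m t by auto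
    next
      case False
      then show ?thesis
        using const[of t] U_reg_bounds(2)[OF F, of m' t] t m nonneg eq by auto
    qed
  next
    fix t assume t: "t \<in> {m'<..b}"
    then show "F t \<le> U_reg a b m' F t + d_S a b F m"
      using U_reg_mono_mode(2)[OF F m t] d_S_upper[OF F, of m t] m by auto
  qed (use m in auto)
qed

lemma partition_props:
  assumes "ts \<in> partitions a b"
  defines "D \<equiv> length ts - 1"
  shows "ts ! 0 = a" "ts ! D = b" "1 \<le> D" "length ts = Suc D"
    "\<And>i j. i < j \<Longrightarrow> j \<le> D \<Longrightarrow> ts ! i < ts ! j"
proof -
  have ts: "2 \<le> length ts" "sorted_wrt (<) ts" "hd ts = a" "last ts = b"
    using assms by (auto simp: partitions_def)
  have "ts \<noteq> []" using ts(1) by auto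
  then show "ts ! 0 = a" "ts ! D = b" "1 \<le> D" "length ts = Suc D"
    using ts(1,3,4) hd_conv_nth[of ts] last_conv_nth[of ts] by (auto simp: D_def)
  show "ts ! i < ts ! j" if "i < j" "j \<le> D" for i j
    using ts(1,2) that by (auto simp: sorted_wrt_iff_nth_less D_def)
qed

lemma partition_cover:
  assumes ts: "ts \<in> partitions a b" and x: "a \<le> x" "x \<le> b"
  obtains k where "Suc k < length ts" "ts ! k \<le> x" "x \<le> ts ! Suc k"
proof -
  define D where "D = length ts - 1"
  note P = partition_props[OF ts, folded D_def]
  define k where "k = Max {k. k < D \<and> ts ! k \<le> x}"
  have "0 \<in> {k. k < D \<and> ts ! k \<le> x}" using P x by auto
  then have "{k. k < D \<and> ts ! k \<le> x} \<noteq> {}" by blast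
  then have k: "k < D" "ts ! k \<le> x"
    using Max_in[of "{k. k < D \<and> ts ! k \<le> x}"] by (auto simp: k_def)
  have "x \<le> ts ! Suc k"
  proof (cases "Suc k = D")
    case False
    then have "Suc k < D" using k by auto
    moreover have "Suc k \<notin> {k. k < D \<and> ts ! k \<le> x}"
      using Max_ge[of "{k. k < D \<and> ts ! k \<le> x}" "Suc k"] by (auto simp flip: k_def)
    ultimately show ?thesis by auto
  qed (use P x in auto)
  then show ?thesis using that[of k] k P by auto
qed

lemma step_on_breakpoints:
  assumes "step_on a b F"
  obtains T where "finite T"
    "\<And>p q. a \<le> p \<Longrightarrow> p < q \<Longrightarrow> q \<le> b \<Longrightarrow> {p<..<q} \<inter> T = {} \<Longrightarrow> F constant_on {p<..<q}"
proof -
  obtain ts where ts: "ts \<in> partitions a b"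
    and const: "\<forall>k\<in>{1..<length ts}. F constant_on {ts ! (k - 1)<..<ts ! k}"
    using assms by (auto simp: step_on_def)
  show ?thesis
  proof (rule that[of "set ts"])
    fix p q assume pq: "a \<le> p" "p < q" "q \<le> b" "{p<..<q} \<inter> set ts = {}"
    obtain k where k: "Suc k < length ts" "ts ! k \<le> (p + q) / 2" "(p + q) / 2 \<le> ts ! Suc k"
      using partition_cover[OF ts, of "(p + q) / 2"] pq by auto
    have "ts ! k \<in> set ts" "ts ! Suc k \<in> set ts" using k by auto
    then have "ts ! k \<notin> {p<..<q}" "ts ! Suc k \<notin> {p<..<q}" using pq by blast+
    then have "{p<..<q} \<subseteq> {ts ! k<..<ts ! Suc k}" using k pq by auto
    moreover have "F constant_on {ts ! k<..<ts ! Suc k}"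
      using const k by (force dest: bspec[of _ _ "Suc k"])
    ultimately show "F constant_on {p<..<q}"
      by (rule constant_on_subset[rotated])
  qed simp
qed

lemma step_on_finite_image:
  assumes "step_on a b F"
  shows "finite (F ` {a..b})"
proof -
  obtain ts where ts: "ts \<in> partitions a b"
    and const: "\<forall>k\<in>{1..<length ts}. F constant_on {ts ! (k - 1)<..<ts ! k}"
    using assms by (auto simp: step_on_def)
  have "F ` {a..b} \<subseteq> F ` set ts \<union> (\<Union>k\<in>{1..<length ts}. F ` {ts ! (k - 1)<..<ts ! k})"
  proof
    fix y assume "y \<in> F ` {a..b}"
    then obtain x where x: "y = F x" "a \<le> x" "x \<le> b" by auto
    obtain k where k: "Suc k < length ts" "ts ! k \<le> x" "x \<le> ts ! Suc k"
      using partition_cover[OF ts x(2,3)] by blast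
    show "y \<in> F ` set ts \<union> (\<Union>k\<in>{1..<length ts}. F ` {ts ! (k - 1)<..<ts ! k})"
    proof (cases "x \<in> set ts")
      case False
      then have "ts ! k < x" "x < ts ! Suc k" using k by (auto simp: less_le)
      then show ?thesis using k x by (intro UnI2 UN_I[of "Suc k"]) auto
    qed (use x in auto)
  qed
  moreover
  have "finite (F ` {ts ! (k - 1)<..<ts ! k})" if k: "k \<in> {1..<length ts}" for k
  proof -
    obtain e where "F ` {ts ! (k - 1)<..<ts ! k} \<subseteq> {e}"
      using const k unfolding constant_on_def by blast
    then show ?thesis by (rule finite_subset) simp
  qed
  then have "finite (F ` set ts \<union> (\<Union>k\<in>{1..<length ts}. F ` {ts ! (k - 1)<..<ts ! k}))"
    by blast
  ultimately show ?thesis by (rule finite_subset)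
qed

text \<open>The set of minimizers is a nonempty interval; it contains its midpoint whether or not it
  contains its ends.\<close>

lemma U_mode_minimizes:
  assumes "a < b" and F: "F \<in> mono_steps a b"
  shows "U_mode a b F \<in> argmin_d_S a b F"
proof -
  have mono: "mono_on {a..b} F" and step: "step_on a b F"
    using F by (auto simp: mono_steps_def)
  let ?d = "d_S a b F"
  let ?A = "argmin_d_S a b F"
  have eq: "?d m = ?d m'" if m: "m \<in> {a..b}" "m' \<in> {a..b}" "F m = F m'" for m m'
  proof (cases "m \<le> m'")
    case True
    show ?thesis by (rule d_S_cong[OF mono _ True _ m(3)]) (use m in auto)
  next
    case False
    show ?thesis by (rule d_S_cong[OF mono _ _ _ m(3)[symmetric], symmetric]) (use m False in auto)
  qed
  have "?d ` {a..b} \<subseteq> (\<lambda>v. ?d (SOME m. m \<in> {a..b} \<and> F m = v)) ` F ` {a..b}"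
  proof
    fix y assume "y \<in> ?d ` {a..b}"
    then obtain m where m: "m \<in> {a..b}" "y = ?d m" by blast
    let ?r = "SOME m'. m' \<in> {a..b} \<and> F m' = F m"
    have r: "?r \<in> {a..b} \<and> F ?r = F m"
      by (rule someI[of "\<lambda>m'. m' \<in> {a..b} \<and> F m' = F m" m]) (use m in auto)
    have "y = ?d ?r"
      using eq[OF m(1) conjunct1[OF r]] r m(2) by argo
    then show "y \<in> (\<lambda>v. ?d (SOME m. m \<in> {a..b} \<and> F m = v)) ` F ` {a..b}"
      using m(1) by blast
  qed
  then have "finite (?d ` {a..b})"
    using step_on_finite_image[OF step] by (meson finite_imageI finite_subset)
  moreover have "?d ` {a..b} \<noteq> {}" using assms(1) by auto
  ultimately have "Min (?d ` {a..b}) \<in> ?d ` {a..b}" "\<And>m. m \<in> {a..b} \<Longrightarrow> Min (?d ` {a..b}) \<le> ?d m"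
    by auto
  then obtain m where "m \<in> {a..b}" "\<And>m'. m' \<in> {a..b} \<Longrightarrow> ?d m \<le> ?d m'"
    by (metis (no_types, lifting) imageE)
  then have ne: "?A \<noteq> {}" by (auto simp: argmin_d_S_def)
  have bdd: "bdd_below ?A" "bdd_above ?A"
    by (auto simp: argmin_d_S_def intro: bdd_belowI[of _ a] bdd_aboveI[of _ b])
  have conv: "z \<in> ?A" if xy: "x \<in> ?A" "y \<in> ?A" "x \<le> z" "z \<le> y" for x y z
  proof -
    have "?d z \<le> max (?d x) (?d y)"
      by (rule d_S_quasiconvex[OF mono]) (use xy in \<open>auto simp: argmin_d_S_def\<close>)
    then show ?thesis
      using xy unfolding argmin_d_S_def by (force simp: max_def split: if_splits)
  qed
  let ?m = "midpoint (Inf ?A) (Sup ?A)"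
  obtain x0 where x0: "x0 \<in> ?A" using ne by blast
  have le: "Inf ?A \<le> x0" "x0 \<le> Sup ?A"
    using bdd x0 by (auto intro: cInf_lower cSup_upper)
  show ?thesis
  proof (cases "Inf ?A = Sup ?A")
    case True
    then have "?m = x0" using le by (simp add: midpoint_def)
    then show ?thesis using x0 by (simp add: U_mode_def)
  next
    case False
    then have "Inf ?A < ?m" "?m < Sup ?A" using le by (auto simp: midpoint_def)
    then obtain x y where "x \<in> ?A" "x < ?m" "y \<in> ?A" "?m < y"
      using cInf_less_iff[OF ne bdd(1)] less_cSup_iff[OF ne bdd(2)] by blast
    then show ?thesis using conv[of x y ?m] by (simp add: U_mode_def)
  qed
qed

lemma concave_on_supergradients:
  fixes f :: "real \<Rightarrow> real"
  assumes "convex S" "\<And>x y. x \<in> S \<Longrightarrow> y \<in> S \<Longrightarrow> f y \<le> f x + k x * (y - x)"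
  shows "concave_on S f"
  unfolding concave_on_iff
proof (intro conjI ballI allI impI)
  fix x y u v :: real
  assume *: "x \<in> S" "y \<in> S" "0 \<le> u" "0 \<le> v" "u + v = 1"
  let ?z = "u *\<^sub>R x + v *\<^sub>R y"
  have z: "?z \<in> S" using assms(1) * by (simp add: convex_def)
  have "u * f x + v * f y \<le> u * (f ?z + k ?z * (x - ?z)) + v * (f ?z + k ?z * (y - ?z))"
    using assms(2)[OF z] * by (intro add_mono mult_left_mono) auto
  also have "\<dots> = (u + v) * f ?z + k ?z * (u * x + v * y - (u + v) * ?z)"
    by (simp add: algebra_simps)
  also have "\<dots> = f ?z" using * by simp
  finally show "u * f x + v * f y \<le> f ?z" .
qed (fact assms(1))

text \<open>With \<open>lcm_le_near_concave\<close> this bounds \<open>d_S\<close> at the mode of \<open>g\<close>.\<close>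

lemma concave_on_primitive_antimono:
  fixes g G :: "real \<Rightarrow> real"
  assumes "antimono_on {s..t} g"
    and int: "\<And>x y. s \<le> x \<Longrightarrow> x \<le> y \<Longrightarrow> y \<le> t \<Longrightarrow> (g has_integral G y - G x) {x..y}"
  shows "concave_on {s..t} G"
proof (rule concave_on_supergradients[of _ _ g])
  fix x y assume xy: "x \<in> {s..t}" "y \<in> {s..t}"
  show "G y \<le> G x + g x * (y - x)"
  proof (cases "x \<le> y")
    case True
    have "G y - G x \<le> g x * (y - x)"
      using has_integral_le[OF int[of x y] has_integral_const_real[of "g x"]] True xy
        monotone_onD[OF assms(1), of x] by (auto simp: mult.commute)
    then show ?thesis by simp
  next
    case False
    have "g x * (x - y) \<le> G x - G y"
      using has_integral_le[OF has_integral_const_real[of "g x"] int[of y x]] False xy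
        monotone_onD[OF assms(1), of _ x] by (auto simp: mult.commute)
    then show ?thesis by (simp add: algebra_simps)
  qed
qed simp

text \<open>Marshall's inequality: a translate of the concave function \<open>H\<close> that lies above \<open>E\<close> also lies above
  the least concave majorant of \<open>E\<close>.\<close>

lemma lcm_le_near_concave:
  fixes E H :: "real \<Rightarrow> real"
  assumes "concave_on S H" "\<And>s. s \<in> S \<Longrightarrow> \<bar>E s - H s - c\<bar> \<le> \<omega>" "t \<in> S"
  shows "least_concave_majorant S E t \<le> E t + 2 * \<omega>"
proof -
  have "concave_on S (\<lambda>x. H x + (c + \<omega>))"
    using assms(1) by (intro concave_on_add) (auto simp: concave_on_const concave_on_imp_convex)
  then have "least_concave_majorant S E t \<le> H t + (c + \<omega>)"
    by (rule lcm_le) (use assms(2,3) in force)+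
  then show ?thesis using assms(2)[OF assms(3)] by linarith
qed

section \<open>The slope of the regularization on either side of the mode\<close>

lemma mono_steps_eventually_const_left:
  assumes F: "F \<in> mono_steps a b"
  shows "\<exists>Fl. \<forall>x. a < x \<longrightarrow> x \<le> b \<longrightarrow> (\<forall>\<^sub>F y in at_left x. F y = Fl x)"
proof -
  have step: "step_on a b F" using F by (auto simp: mono_steps_def)
  obtain T where T: "finite T"
    "\<And>p q. a \<le> p \<Longrightarrow> p < q \<Longrightarrow> q \<le> b \<Longrightarrow> {p<..<q} \<inter> T = {} \<Longrightarrow> F constant_on {p<..<q}"
    using step_on_breakpoints[OF step] by blast
  have "\<exists>v. \<forall>\<^sub>F y in at_left x. F y = v" if x: "a < x" "x \<le> b" for x
  proof -
    obtain p where p: "a \<le> p" "p < x" "{p<..<x} \<inter> T = {}"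
      by (rule finite_avoid_left[OF T(1) x(1)])
    obtain v where "\<forall>y\<in>{p<..<x}. F y = v"
      using T(2)[OF p(1,2) x(2) p(3)] by (auto simp: constant_on_def)
    then have "\<forall>\<^sub>F y in at_left x. F y = v"
      using eventually_at_left_real[OF p(2)] by (auto elim: eventually_mono)
    then show ?thesis by blast
  qed
  then show ?thesis by metis
qed

lemma mono_steps_eventually_const_right:
  assumes F: "F \<in> mono_steps a b" and x: "a \<le> x" "x < b"
  shows "\<forall>\<^sub>F y in at_right x. F y = F x"
proof -
  have cadlag: "cadlag_on a b F" and step: "step_on a b F"
    using F by (auto simp: mono_steps_def)
  obtain T where T: "finite T"
    "\<And>p q. a \<le> p \<Longrightarrow> p < q \<Longrightarrow> q \<le> b \<Longrightarrow> {p<..<q} \<inter> T = {} \<Longrightarrow> F constant_on {p<..<q}"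
    using step_on_breakpoints[OF step] by blast
  obtain q where q: "x < q" "q \<le> b" "{x<..<q} \<inter> T = {}"
    by (rule finite_avoid_right[OF T(1) x(2)])
  obtain v where "\<forall>y\<in>{x<..<q}. F y = v"
    using T(2)[OF x(1) q] by (auto simp: constant_on_def)
  then have ev: "\<forall>\<^sub>F y in at_right x. F y = v"
    using eventually_at_right_real[OF q(1)] by (auto elim: eventually_mono)
  then have "(F \<longlongrightarrow> v) (at_right x)" by (rule tendsto_eventually)
  moreover have "(F \<longlongrightarrow> F x) (at_right x)"
    using cadlag x by (auto simp: cadlag_on_def)
  ultimately have "v = F x" using tendsto_unique trivial_limit_at_right_real by blast
  then show ?thesis using ev by simp
qed

lemma eventually_nhds_split_real:
  fixes x :: real
  assumes "eventually P (at_left x)" "eventually P (at_right x)" "P x"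
  shows "eventually P (nhds x)"
  using assms by (auto simp: eventually_nhds_conv_at eventually_at_split)

text \<open>A nondecreasing right-continuous \<open>F\<close> is upper semicontinuous, so \<open>\<Phi>\<close> touches \<open>F\<close>
  itself where the slope drops.\<close>

lemma U_slope_left_of_mode:
  assumes F: "F \<in> mono_steps a b" and \<mu>: "\<mu> \<in> {a..b}"
  obtains \<Phi> where
    "antimono_on {a<..<\<mu>} (U_slope a b \<mu> F)"
    "\<And>x y. a \<le> x \<Longrightarrow> x \<le> y \<Longrightarrow> y \<le> \<mu> \<Longrightarrow> (U_slope a b \<mu> F has_integral \<Phi> y - \<Phi> x) {x..y}"
    "\<And>x. x \<in> {a..\<mu>} \<Longrightarrow> F x \<le> \<Phi> x"
    "\<And>x. x \<in> {a..\<mu>} \<Longrightarrow> \<Phi> x \<le> F x + d_S a b F \<mu>"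
    "\<And>x d. a < x \<Longrightarrow> x < \<mu> \<Longrightarrow> \<forall>\<^sub>F y in at_left x. d < U_slope a b \<mu> F y \<Longrightarrow>
      \<forall>\<^sub>F y in at_right x. U_slope a b \<mu> F y \<le> d \<Longrightarrow> \<Phi> x \<le> F x"
    "\<Phi> a \<le> F a"
proof (cases "a = \<mu>")
  case True
  have "mono_on {a..b} F" using F by (auto simp: mono_steps_def)
  then have "0 \<le> d_S a b F \<mu>" by (rule d_S_nonneg[OF _ \<mu>])
  moreover have "(U_slope a b \<mu> F has_integral F y - F x) {x..y}"
    if "a \<le> x" "x \<le> y" "y \<le> \<mu>" for x y
  proof -
    have "x = \<mu>" "y = \<mu>" using that True by auto
    then show ?thesis using has_integral_refl(1)[of _ \<mu>] by simp
  qed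
  ultimately show ?thesis
    using True by (intro that[of F]) (auto simp: monotone_on_def)
next
  case False
  then have a\<mu>: "a < \<mu>" "\<mu> \<le> b" using \<mu> by auto
  have monoF: "mono_on {a..b} F" and step: "step_on a b F"
    using F by (auto simp: mono_steps_def)
  have mono: "F x \<le> F y" if "a \<le> x" "x \<le> y" "y \<le> b" for x y
    using that by (auto intro!: mono_onD[OF monoF])
  note right = mono_steps_eventually_const_right[OF F]
  obtain T where T: "finite T"
    "\<And>p q. a \<le> p \<Longrightarrow> p < q \<Longrightarrow> q \<le> b \<Longrightarrow> {p<..<q} \<inter> T = {} \<Longrightarrow> F constant_on {p<..<q}"
    using step_on_breakpoints[OF step] by blast
  have T': "F constant_on {p<..<q}" if "a \<le> p" "p < q" "q \<le> \<mu>" "{p<..<q} \<inter> T = {}" for p q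
    using T(2)[OF that(1,2) _ that(4)] that a\<mu> by auto
  have bd: "F s \<le> F \<mu>" if "s \<in> {a..\<mu>}" for s using mono that a\<mu> by auto
  let ?L = "least_concave_majorant {a..\<mu>} F"
  let ?u = "U_slope a b \<mu> F"
  show ?thesis
  proof (rule lcm_step_regularity[OF a\<mu>(1) T(1) T' bd])
    fix \<Phi> \<phi> :: "real \<Rightarrow> real"
    assume
      L: "\<And>x. a < x \<Longrightarrow> x < \<mu> \<Longrightarrow> \<Phi> x = ?L x" and
      aff: "\<And>x. a < x \<Longrightarrow> x < \<mu> \<Longrightarrow> \<exists>q. x < q \<and> q \<le> \<mu> \<and> (\<forall>z. x \<le> z \<longrightarrow> z < q \<longrightarrow> ?L z = ?L x + \<phi> x * (z - x))" and
      anti: "antimono_on {a<..<\<mu>} \<phi>" and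
      int: "\<And>x y. a \<le> x \<Longrightarrow> x \<le> y \<Longrightarrow> y \<le> \<mu> \<Longrightarrow> (\<phi> has_integral \<Phi> y - \<Phi> x) {x..y}" and
      touch: "\<And>x d v. a < x \<Longrightarrow> x < \<mu> \<Longrightarrow> \<forall>\<^sub>F y in at_left x. d < \<phi> y \<Longrightarrow>
        \<forall>\<^sub>F y in at_right x. \<phi> y \<le> d \<Longrightarrow> \<forall>\<^sub>F y in nhds x. F y \<le> v \<Longrightarrow> \<Phi> x \<le> v" and
      endA: "\<And>v. \<forall>\<^sub>F y in at_right a. F y \<le> v \<Longrightarrow> F a \<le> v \<Longrightarrow> \<Phi> a \<le> v" and
      endB: "\<And>v. \<forall>\<^sub>F y in at_left \<mu>. F y \<le> v \<Longrightarrow> F \<mu> \<le> v \<Longrightarrow> \<Phi> \<mu> \<le> v" and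
      lowR: "\<And>x v. a \<le> x \<Longrightarrow> x < \<mu> \<Longrightarrow> \<forall>\<^sub>F y in at_right x. v \<le> F y \<Longrightarrow> v \<le> \<Phi> x" and
      lowB: "F \<mu> \<le> \<Phi> \<mu>"
    have slope: "?u x = \<phi> x" if x: "a < x" "x < \<mu>" for x
    proof -
      obtain q where q: "x < q" "q \<le> \<mu>" "\<forall>z. x \<le> z \<longrightarrow> z < q \<longrightarrow> ?L z = ?L x + \<phi> x * (z - x)"
        using aff[OF x] by blast
      show ?thesis
        unfolding U_slope_def
      proof (rule vector_derivative_at_right_affine[OF q(1)])
        fix z assume z: "x \<le> z" "z < q"
        then have "?L z = ?L x + \<phi> x * (z - x)" using q(3) by blast
        then show "U_reg a b \<mu> F z = U_reg a b \<mu> F x + \<phi> x * (z - x)"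
          using z q(2) x by (simp add: U_reg_def)
      qed
    qed
    have R: "\<forall>\<^sub>F y in at_right x. F y \<le> F x" if "a \<le> x" "x < \<mu>" for x
      using right[of x] that a\<mu> by (auto elim: eventually_mono)
    have \<Phi>a: "\<Phi> a \<le> F a" by (rule endA) (use R[of a] a\<mu> in auto)
    have Lf: "\<forall>\<^sub>F y in at_left x. F y \<le> F x" if "a < x" "x \<le> \<mu>" for x
      using eventually_at_left_real[OF that(1)]
      by eventually_elim (use that a\<mu> in \<open>auto intro!: mono\<close>)
    have \<Phi>\<mu>: "\<Phi> \<mu> \<le> F \<mu>" by (rule endB) (use Lf[of \<mu>] a\<mu> in auto)
    have ge: "F x \<le> \<Phi> x" if x: "x \<in> {a..\<mu>}" for x
    proof (cases "x = \<mu>")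
      case False
      then have x': "a \<le> x" "x < \<mu>" "x < b" using x a\<mu> by auto
      have "\<forall>\<^sub>F y in at_right x. F x \<le> F y"
        using eventually_at_right_real[OF x'(3)]
        by eventually_elim (use x' in \<open>auto intro!: mono\<close>)
      then show ?thesis by (rule lowR[OF x'(1,2)])
    qed (use lowB in simp)
    show ?thesis
    proof (rule that[of \<Phi>])
      show "antimono_on {a<..<\<mu>} ?u"
        using anti slope by (auto simp: monotone_on_def)
      show "(?u has_integral \<Phi> y - \<Phi> x) {x..y}" if "a \<le> x" "x \<le> y" "y \<le> \<mu>" for x y
        by (rule has_integral_spike_finite[OF _ _ int[OF that], of "{x, y}"])
          (use that slope in auto)
      show "F x \<le> \<Phi> x" if "x \<in> {a..\<mu>}" for x by (rule ge[OF that])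
      show "\<Phi> x \<le> F x + d_S a b F \<mu>" if x: "x \<in> {a..\<mu>}" for x
      proof -
        consider "x = a" | "x = \<mu>" | "a < x" "x < \<mu>" using x by force
        then show ?thesis
        proof cases
          case 3
          have "\<bar>F x - U_reg a b \<mu> F x\<bar> \<le> d_S a b F \<mu>"
            by (rule d_S_upper[OF monoF \<mu>]) (use 3 a\<mu> in auto)
          then show ?thesis using L[OF 3] 3 by (simp add: U_reg_def)
        qed (use \<Phi>a \<Phi>\<mu> d_S_nonneg[OF monoF \<mu>] in auto)
      qed
      show "\<Phi> x \<le> F x" if x: "a < x" "x < \<mu>"
        and l: "\<forall>\<^sub>F y in at_left x. d < ?u y" and r: "\<forall>\<^sub>F y in at_right x. ?u y \<le> d" for x d
      proof (rule touch[OF x])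
        show "\<forall>\<^sub>F y in at_left x. d < \<phi> y"
          using l eventually_at_left_real[OF x(1)] by eventually_elim (use slope x in auto)
        show "\<forall>\<^sub>F y in at_right x. \<phi> y \<le> d"
          using r eventually_at_right_real[OF x(2)] by eventually_elim (use slope x in auto)
        show "\<forall>\<^sub>F y in nhds x. F y \<le> F x"
          using Lf[of x] R[of x] x by (intro eventually_nhds_split_real) auto
      qed
    qed (fact \<Phi>a)
  qed
qed

text \<open>Here \<open>\<Psi>\<close> is a continuous version of the negative of the convex minorant. It touches
  \<open>- Fl\<close>, with \<open>Fl\<close> the left limits of \<open>F\<close>, since \<open>- F\<close> jumps downwards. If \<open>\<mu> < b\<close>, then \<open>\<Psi> b\<close>
  equals \<open>- Fl b\<close>, because a jump of \<open>F\<close> at \<open>b\<close> affects the convex minorant at \<open>b\<close> only.\<close>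

lemma U_slope_right_of_mode:
  assumes F: "F \<in> mono_steps a b" and \<mu>: "\<mu> \<in> {a..b}"
    and left: "\<And>x. a < x \<Longrightarrow> x \<le> b \<Longrightarrow> \<forall>\<^sub>F y in at_left x. F y = Fl x"
  obtains \<Psi> where
    "antimono_on {\<mu><..<b} (\<lambda>x. - U_slope a b \<mu> F x)"
    "\<And>x y. \<mu> \<le> x \<Longrightarrow> x \<le> y \<Longrightarrow> y \<le> b \<Longrightarrow>
      ((\<lambda>x. - U_slope a b \<mu> F x) has_integral \<Psi> y - \<Psi> x) {x..y}"
    "\<And>x. \<mu> \<le> x \<Longrightarrow> x < b \<Longrightarrow> - F x \<le> \<Psi> x"
    "\<And>x. \<mu> \<le> x \<Longrightarrow> x < b \<Longrightarrow> \<Psi> x \<le> - F x + d_S a b F \<mu>"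
    "\<And>x. \<mu> < x \<Longrightarrow> x \<le> b \<Longrightarrow> - Fl x \<le> \<Psi> x"
    "\<And>x d. \<mu> < x \<Longrightarrow> x < b \<Longrightarrow> \<forall>\<^sub>F y in at_left x. d < - U_slope a b \<mu> F y \<Longrightarrow>
      \<forall>\<^sub>F y in at_right x. - U_slope a b \<mu> F y \<le> d \<Longrightarrow> \<Psi> x \<le> - Fl x"
    "\<mu> < b \<Longrightarrow> \<Psi> b \<le> - Fl b" "\<mu> = b \<Longrightarrow> \<Psi> b = - F b"
proof (cases "\<mu> = b")
  case True
  have "((\<lambda>x. - U_slope a b \<mu> F x) has_integral - F y - - F x) {x..y}"
    if "\<mu> \<le> x" "x \<le> y" "y \<le> b" for x y
  proof -
    have "x = b" "y = b" using that True by auto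
    then show ?thesis using has_integral_refl(1)[of _ b] by simp
  qed
  then show ?thesis
    using True by (intro that[of "\<lambda>x. - F x"]) (auto simp: monotone_on_def)
next
  case False
  then have b\<mu>: "\<mu> < b" "a \<le> \<mu>" using \<mu> by auto
  have monoF: "mono_on {a..b} F" and step: "step_on a b F"
    using F by (auto simp: mono_steps_def)
  have mono: "F x \<le> F y" if "a \<le> x" "x \<le> y" "y \<le> b" for x y
    using that by (auto intro!: mono_onD[OF monoF])
  note right = mono_steps_eventually_const_right[OF F]
  obtain T where T: "finite T"
    "\<And>p q. a \<le> p \<Longrightarrow> p < q \<Longrightarrow> q \<le> b \<Longrightarrow> {p<..<q} \<inter> T = {} \<Longrightarrow> F constant_on {p<..<q}"
    using step_on_breakpoints[OF step] by blast
  have T': "(\<lambda>x. - F x) constant_on {p<..<q}" if "\<mu> \<le> p" "p < q" "q \<le> b" "{p<..<q} \<inter> T = {}" for p q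
    using T(2)[OF _ that(2-4)] that b\<mu> by (auto simp: constant_on_def)
  have bd: "- F s \<le> - F \<mu>" if "s \<in> {\<mu>..b}" for s using mono that b\<mu> by auto
  have Fl_le: "Fl x \<le> F x" if x: "a < x" "x \<le> b" for x
  proof -
    have "\<forall>\<^sub>F y in at_left x. Fl x \<le> F x"
      using left[OF x] eventually_at_left_real[OF x(1)]
    proof eventually_elim
      case (elim y)
      then show ?case using mono[of y x] x by auto
    qed
    then show ?thesis by (simp add: eventually_const trivial_limit_at_left_real)
  qed
  let ?L = "least_concave_majorant {\<mu>..b} (\<lambda>x. - F x)"
  let ?u = "\<lambda>x. - U_slope a b \<mu> F x"
  show ?thesis
  proof (rule lcm_step_regularity[where E="\<lambda>x. - F x", OF b\<mu>(1) T(1) T' bd])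
    fix \<Psi> \<psi> :: "real \<Rightarrow> real"
    assume
      L: "\<And>x. \<mu> < x \<Longrightarrow> x < b \<Longrightarrow> \<Psi> x = ?L x" and
      aff: "\<And>x. \<mu> < x \<Longrightarrow> x < b \<Longrightarrow> \<exists>q. x < q \<and> q \<le> b \<and> (\<forall>z. x \<le> z \<longrightarrow> z < q \<longrightarrow> ?L z = ?L x + \<psi> x * (z - x))" and
      anti: "antimono_on {\<mu><..<b} \<psi>" and
      int: "\<And>x y. \<mu> \<le> x \<Longrightarrow> x \<le> y \<Longrightarrow> y \<le> b \<Longrightarrow> (\<psi> has_integral \<Psi> y - \<Psi> x) {x..y}" and
      touch: "\<And>x d v. \<mu> < x \<Longrightarrow> x < b \<Longrightarrow> \<forall>\<^sub>F y in at_left x. d < \<psi> y \<Longrightarrow>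
        \<forall>\<^sub>F y in at_right x. \<psi> y \<le> d \<Longrightarrow> \<forall>\<^sub>F y in nhds x. - F y \<le> v \<Longrightarrow> \<Psi> x \<le> v" and
      endA: "\<And>v. \<forall>\<^sub>F y in at_right \<mu>. - F y \<le> v \<Longrightarrow> - F \<mu> \<le> v \<Longrightarrow> \<Psi> \<mu> \<le> v" and
      endB: "\<And>v. \<forall>\<^sub>F y in at_left b. - F y \<le> v \<Longrightarrow> - F b \<le> v \<Longrightarrow> \<Psi> b \<le> v" and
      lowR: "\<And>x v. \<mu> \<le> x \<Longrightarrow> x < b \<Longrightarrow> \<forall>\<^sub>F y in at_right x. v \<le> - F y \<Longrightarrow> v \<le> \<Psi> x" and
      lowL: "\<And>x v. \<mu> < x \<Longrightarrow> x \<le> b \<Longrightarrow> \<forall>\<^sub>F y in at_left x. v \<le> - F y \<Longrightarrow> v \<le> \<Psi> x"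
    have slope: "?u x = \<psi> x" if x: "\<mu> < x" "x < b" for x
    proof -
      obtain q where q: "x < q" "q \<le> b" "\<forall>z. x \<le> z \<longrightarrow> z < q \<longrightarrow> ?L z = ?L x + \<psi> x * (z - x)"
        using aff[OF x] by blast
      have "U_slope a b \<mu> F x = - \<psi> x"
        unfolding U_slope_def
      proof (rule vector_derivative_at_right_affine[OF q(1)])
        fix z assume z: "x \<le> z" "z < q"
        then have "?L z = ?L x + \<psi> x * (z - x)" using q(3) by blast
        then show "U_reg a b \<mu> F z = U_reg a b \<mu> F x + - \<psi> x * (z - x)"
          using z q(2) x by (simp add: U_reg_def gcm_eq_neg_lcm)
      qed
      then show ?thesis by simp
    qed
    have R: "\<forall>\<^sub>F y in at_right x. - F y \<le> v" if "\<mu> \<le> x" "x < b" "- F x \<le> v" for x v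
      using right[of x] that b\<mu> by (auto elim: eventually_mono)
    have R': "\<forall>\<^sub>F y in at_right x. - F x \<le> - F y" if "\<mu> \<le> x" "x < b" for x
      using right[of x] that b\<mu> by (auto elim: eventually_mono)
    have Lf: "\<forall>\<^sub>F y in at_left x. - F y = - Fl x" if "\<mu> < x" "x \<le> b" for x
      using left[of x] that b\<mu> by (auto elim: eventually_mono)
    have \<Psi>\<mu>: "\<Psi> \<mu> \<le> - F \<mu>" using R[of \<mu> "- F \<mu>"] b\<mu> by (intro endA) simp_all
    have \<Psi>b: "\<Psi> b \<le> - Fl b"
      by (rule endB) (use Lf[of b] Fl_le[of b] b\<mu> in \<open>auto elim: eventually_mono\<close>)
    show ?thesis
    proof (rule that[of \<Psi>])
      show "antimono_on {\<mu><..<b} ?u"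
        using anti slope by (auto simp: monotone_on_def)
      show "(?u has_integral \<Psi> y - \<Psi> x) {x..y}" if "\<mu> \<le> x" "x \<le> y" "y \<le> b" for x y
        by (rule has_integral_spike_finite[OF _ _ int[OF that], of "{x, y}"])
          (use that slope in auto)
      show "- F x \<le> \<Psi> x" if "\<mu> \<le> x" "x < b" for x
        by (rule lowR[OF that R'[OF that]])
      show "\<Psi> x \<le> - F x + d_S a b F \<mu>" if x: "\<mu> \<le> x" "x < b" for x
      proof (cases "x = \<mu>")
        case True
        then show ?thesis using \<Psi>\<mu> d_S_nonneg[OF monoF \<mu>] by auto
      next
        case False
        then have x': "\<mu> < x" "x < b" using x by auto
        have "\<bar>F x - U_reg a b \<mu> F x\<bar> \<le> d_S a b F \<mu>"
          by (rule d_S_upper[OF monoF \<mu>]) (use x b\<mu> in auto)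
        then show ?thesis using L[OF x'] x' by (simp add: U_reg_def gcm_eq_neg_lcm)
      qed
      show "- Fl x \<le> \<Psi> x" if "\<mu> < x" "x \<le> b" for x
        by (rule lowL[OF that]) (use Lf[OF that] in \<open>auto elim: eventually_mono\<close>)
      show "\<Psi> x \<le> - Fl x" if x: "\<mu> < x" "x < b"
        and l: "\<forall>\<^sub>F y in at_left x. d < ?u y" and r: "\<forall>\<^sub>F y in at_right x. ?u y \<le> d" for x d
      proof (rule touch[OF x])
        show "\<forall>\<^sub>F y in at_left x. d < \<psi> y"
          using l eventually_at_left_real[OF x(1)] by eventually_elim (use slope x in auto)
        show "\<forall>\<^sub>F y in at_right x. \<psi> y \<le> d"
          using r eventually_at_right_real[OF x(2)] by eventually_elim (use slope x in auto)
        show "\<forall>\<^sub>F y in nhds x. - F y \<le> - Fl x"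
          using Lf[of x] R[of x "- Fl x"] Fl_le[of x] x b\<mu>
          by (intro eventually_nhds_split_real) (auto elim: eventually_mono)
      qed
    qed (use \<Psi>b False in auto)
  qed
qed

section \<open>The risk for a fixed sample\<close>

lemma second_difference_le:
  fixes x :: real
  assumes "\<bar>x - z\<bar> \<le> w" "\<bar>y - z\<bar> \<le> w" "\<bar>y' - z\<bar> \<le> w"
  shows "2 * x - y - y' \<le> 4 * w"
  using assms by linarith

text \<open>The data for one sample: \<open>m\<close> is a mode of \<open>g\<close>, \<open>G\<close> is a primitive of \<open>g\<close>,
  and \<open>\<omega> k\<close> bounds the oscillation of \<open>F - G\<close> on the cell number \<open>k\<close>, counted from
  zero.\<close>

locale step_estimate =
  fixes a b m :: real and g F G :: "real \<Rightarrow> real" and ts :: "real list" and \<omega> :: "nat \<Rightarrow> real"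
  assumes ab: "a < b" and m: "m \<in> {a..b}"
    and g_left: "antimono_on {a..m} g" and g_right: "mono_on {m..b} g"
    and G: "\<And>x y. a \<le> x \<Longrightarrow> x \<le> y \<Longrightarrow> y \<le> b \<Longrightarrow> (g has_integral G y - G x) {x..y}"
    and F: "F \<in> mono_steps a b"
    and ts: "ts \<in> partitions a b"
    and osc: "\<And>k x. Suc k < length ts \<Longrightarrow> x \<in> {ts ! k..ts ! Suc k} \<Longrightarrow>
      \<bar>(F x - G x) - (F (ts ! k) - G (ts ! k))\<bar> \<le> \<omega> k"
begin

abbreviation "Z x \<equiv> F x - G x"

abbreviation "D \<equiv> length ts - 1"

abbreviation "\<mu> \<equiv> U_mode a b F"

definition "\<Omega> = (\<Sum>k<D. \<omega> k)"

lemmas ts_props = partition_props[OF ts]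

lemma mono_F: "mono_on {a..b} F" using F by (simp add: mono_steps_def)

lemma ts_le: "i \<le> j \<Longrightarrow> j \<le> D \<Longrightarrow> ts ! i \<le> ts ! j"
  using ts_props(5)[of i j] by (cases "i = j") auto

lemma ts_in: "k \<le> D \<Longrightarrow> ts ! k \<in> {a..b}"
  using ts_le[of 0 k] ts_le[of k D] ts_props(1,2) by auto

lemma osc': "k < D \<Longrightarrow> ts ! k \<le> x \<Longrightarrow> x \<le> ts ! Suc k \<Longrightarrow> \<bar>Z x - Z (ts ! k)\<bar> \<le> \<omega> k"
  using osc[of k x] by auto

lemma \<omega>_nonneg: "k < D \<Longrightarrow> 0 \<le> \<omega> k"
  using osc'[of k "ts ! k"] ts_le[of k "Suc k"] by auto

lemma \<Omega>_nonneg: "0 \<le> \<Omega>"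
  unfolding \<Omega>_def by (intro sum_nonneg) (use \<omega>_nonneg in auto)

lemma Z_close:
  assumes "x \<in> {a..b}"
  shows "\<bar>Z x - Z a\<bar> \<le> \<Omega>"
proof -
  have *: "\<bar>Z (ts ! k) - Z a\<bar> \<le> (\<Sum>i<k. \<omega> i)" if "k \<le> D" for k
    using that
  proof (induction k)
    case 0
    show ?case using ts_props(1) by simp
  next
    case (Suc k)
    have "\<bar>Z (ts ! Suc k) - Z (ts ! k)\<bar> \<le> \<omega> k"
      using Suc.prems ts_le[of k "Suc k"] by (intro osc') auto
    then show ?case using Suc by simp
  qed
  obtain k where k: "Suc k < length ts" "ts ! k \<le> x" "x \<le> ts ! Suc k"
    using partition_cover[OF ts, of x] assms by auto
  have "\<bar>Z x - Z (ts ! k)\<bar> \<le> \<omega> k" using k by (intro osc') auto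
  moreover have "\<bar>Z (ts ! k) - Z a\<bar> \<le> (\<Sum>i<k. \<omega> i)" using k by (intro *) auto
  ultimately have "\<bar>Z x - Z a\<bar> \<le> (\<Sum>i<Suc k. \<omega> i)" by simp
  also have "\<dots> \<le> \<Omega>"
    unfolding \<Omega>_def by (intro sum_mono2) (use k \<omega>_nonneg in auto)
  finally show ?thesis .
qed

lemma G_left_limit:
  assumes "a < x" "x \<le> b"
  shows "(G \<longlongrightarrow> G x) (at_left x)"
proof -
  have "g integrable_on {a..b}" using G[of a b] ab by (auto simp: integrable_on_def)
  then have "continuous_on {a..b} (\<lambda>x. G a + integral {a..x} g)"
    by (intro continuous_intros indefinite_integral_continuous_1)
  moreover have "G a + integral {a..x} g = G x" if "x \<in> {a..b}" for x
    using integral_unique[OF G[of a x]] that by simp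
  ultimately have "continuous_on {a..b} G"
    by (rule continuous_on_eq)
  then have "(G \<longlongrightarrow> G x) (at x within {a..b})" using assms by (simp add: continuous_on_def)
  then have "(G \<longlongrightarrow> G x) (at x within {a..x})"
    by (rule tendsto_within_subset) (use assms in auto)
  then show ?thesis using assms by (simp add: at_within_Icc_at_left)
qed

text \<open>At the mode of \<open>g\<close> both halves of the regularization are controlled by Marshall's inequality,
  the comparison functions being translates of \<open>G\<close> and of \<open>- G\<close>.\<close>

lemma d_S_true_mode: "d_S a b F m \<le> 2 * \<Omega>"
proof (rule d_S_leI[OF mono_F m])
  fix t assume t: "t \<in> {a..m}"
  have "concave_on {a..m} G"
    by (rule concave_on_primitive_antimono[OF g_left G]) (use m in auto)
  then have "least_concave_majorant {a..m} F t \<le> F t + 2 * \<Omega>"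
    by (rule lcm_le_near_concave[where E=F, OF _ Z_close t]) (use m in auto)
  then show "U_reg a b m F t \<le> F t + 2 * \<Omega>" using t by (simp add: U_reg_def)
next
  fix t assume t: "t \<in> {m<..b}"
  have conc: "concave_on {m..b} (\<lambda>x. - G x)"
  proof (rule concave_on_primitive_antimono[where g="\<lambda>x. - g x"])
    show "antimono_on {m..b} (\<lambda>x. - g x)" using g_right by (auto simp: monotone_on_def)
    show "((\<lambda>x. - g x) has_integral - G y - - G x) {x..y}" if "m \<le> x" "x \<le> y" "y \<le> b" for x y
      using has_integral_neg[OF G[of x y]] that m by simp
  qed
  have "least_concave_majorant {m..b} (\<lambda>x. - F x) t \<le> - F t + 2 * \<Omega>"
  proof (rule lcm_le_near_concave[where c="- Z a", OF conc])
    show "\<bar>- F s - - G s - - Z a\<bar> \<le> \<Omega>" if "s \<in> {m..b}" for s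
      using Z_close[of s] that m by auto
  qed (use t in auto)
  then show "F t \<le> U_reg a b m F t + 2 * \<Omega>" using t by (simp add: U_reg_def gcm_eq_neg_lcm)
qed

lemma \<mu>_in: "\<mu> \<in> {a..b}" and d_S_\<mu>: "d_S a b F \<mu> \<le> 2 * \<Omega>"
  using U_mode_minimizes[OF ab F] d_S_true_mode m by (force simp: argmin_d_S_def)+

lemma integrable_abs_diff:
  assumes "a \<le> x" "y \<le> b"
  shows "(\<lambda>t. \<bar>g t - c\<bar>) integrable_on {x..y}"
proof -
  have g_c: "((\<lambda>t. g t - c) has_integral (G y - c * y) - (G x - c * x)) {x..y}"
    if "a \<le> x" "x \<le> y" "y \<le> b" for x y
    using has_integral_diff[OF G[OF that] has_integral_const_real, of c] that
    by (simp add: algebra_simps)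
  have "(\<lambda>t. g t - c) absolutely_integrable_on {a..m}"
    by (rule antimono_absolutely_integrable[OF _ _ g_c])
      (use m g_left in \<open>auto simp: monotone_on_def\<close>)
  moreover have "(\<lambda>t. - (g t - c)) absolutely_integrable_on {m..b}"
  proof (rule antimono_absolutely_integrable)
    show "((\<lambda>t. - (g t - c)) has_integral - (G y - c * y) - - (G x - c * x)) {x..y}"
      if "m \<le> x" "x \<le> y" "y \<le> b" for x y
      using has_integral_neg[OF g_c[of x y]] that m by (simp add: algebra_simps)
  qed (use m g_right in \<open>auto simp: monotone_on_def\<close>)
  ultimately have "(\<lambda>t. \<bar>g t - c\<bar>) integrable_on {a..m}" "(\<lambda>t. \<bar>g t - c\<bar>) integrable_on {m..b}"
    by (simp_all add: absolutely_integrable_on_def abs_minus_commute)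
  then have "(\<lambda>t. \<bar>g t - c\<bar>) integrable_on {a..b}"
    using m by (intro Henstock_Kurzweil_Integration.integrable_combine[of a m b]) auto
  then show ?thesis by (rule integrable_on_subinterval) (use assms in auto)
qed

lemma integral_sub_cell_le:
  assumes "k < D" "x \<le> y \<Longrightarrow> ts ! k \<le> x" "x \<le> y \<Longrightarrow> y \<le> ts ! Suc k"
  shows "integral {x..y} (\<lambda>t. \<bar>g t - c\<bar>) \<le> integral {ts ! k..ts ! Suc k} (\<lambda>t. \<bar>g t - c\<bar>)"
proof -
  have cell: "a \<le> ts ! k" "ts ! Suc k \<le> b" using assms ts_in[of k] ts_in[of "Suc k"] by auto
  have int: "(\<lambda>t. \<bar>g t - c\<bar>) integrable_on {ts ! k..ts ! Suc k}"
    by (rule integrable_abs_diff[OF cell])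
  show ?thesis
  proof (cases "x \<le> y")
    case True
    show ?thesis
      by (rule integral_subset_le[OF _ _ int]) (use True assms cell in \<open>auto intro!: integrable_abs_diff\<close>)
  next
    case False
    then show ?thesis using integral_nonneg[OF int] by simp
  qed
qed

text \<open>The interval ends at \<open>m1\<close>, which may lie strictly before \<open>\<mu>\<close>. Then \<open>\<Phi>\<close> need not
  touch \<open>F\<close> at \<open>m1\<close>, but the excess is at most \<open>d_S \<mu>\<close>.\<close>

lemma left_part:
  assumes m1: "m1 \<in> {a..m}" "m1 \<le> \<mu>"
  shows "(\<lambda>t. \<bar>U_S a b F t - g t\<bar>) integrable_on {a..m1}"
    and "integral {a..m1} (\<lambda>t. \<bar>U_S a b F t - g t\<bar>)
      \<le> 6 * \<Omega> + 2 * (\<Sum>k<D. integral {ts ! k..ts ! Suc k} (\<lambda>t. \<bar>g t - c k\<bar>))"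
proof -
  let ?u = "U_slope a b \<mu> F"
  let ?p = "\<lambda>k. min (ts ! k) m1"
  have "(\<lambda>t. \<bar>?u t - g t\<bar>) integrable_on {a..m1} \<and>
    integral {a..m1} (\<lambda>t. \<bar>?u t - g t\<bar>)
      \<le> 6 * \<Omega> + 2 * (\<Sum>k<D. integral {ts ! k..ts ! Suc k} (\<lambda>t. \<bar>g t - c k\<bar>))"
  proof (rule U_slope_left_of_mode[OF F \<mu>_in])
    fix \<Phi>
    assume anti: "antimono_on {a<..<\<mu>} ?u"
      and int: "\<And>x y. a \<le> x \<Longrightarrow> x \<le> y \<Longrightarrow> y \<le> \<mu> \<Longrightarrow> (?u has_integral \<Phi> y - \<Phi> x) {x..y}"
      and ge: "\<And>x. x \<in> {a..\<mu>} \<Longrightarrow> F x \<le> \<Phi> x"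
      and le: "\<And>x. x \<in> {a..\<mu>} \<Longrightarrow> \<Phi> x \<le> F x + d_S a b F \<mu>"
      and touch: "\<And>x d. a < x \<Longrightarrow> x < \<mu> \<Longrightarrow> \<forall>\<^sub>F y in at_left x. d < ?u y \<Longrightarrow>
        \<forall>\<^sub>F y in at_right x. ?u y \<le> d \<Longrightarrow> \<Phi> x \<le> F x"
      and \<Phi>a: "\<Phi> a \<le> F a"
    have p: "?p 0 = a" "?p D = m1"
      using ts_props(1,2) m1 m by (auto simp: min_def)
    have osc_cell: "2 * (F r - G r) - (F (?p k) - G (?p k)) - (F (?p (Suc k)) - G (?p (Suc k))) \<le> 4 * \<omega> k"
      if k: "k < D" and r: "r \<in> {?p k..?p (Suc k)}" for k r
    proof (cases "ts ! k < m1")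
      case True
      have "\<bar>Z x - Z (ts ! k)\<bar> \<le> \<omega> k" if "x \<in> {?p k..?p (Suc k)}" for x
        using that True k by (intro osc') auto
      then have "\<bar>Z r - Z (ts ! k)\<bar> \<le> \<omega> k" "\<bar>Z (?p k) - Z (ts ! k)\<bar> \<le> \<omega> k"
          "\<bar>Z (?p (Suc k)) - Z (ts ! k)\<bar> \<le> \<omega> k"
        using r by simp_all
      then show ?thesis by (rule second_difference_le)
    next
      case False
      then have "?p k = m1" "?p (Suc k) = m1" using ts_le[of k "Suc k"] k by auto
      then show ?thesis using r \<omega>_nonneg[OF k] by auto
    qed
    note core = monotone_slope_L1_bound[of D ?p ?u g \<Phi> G F "\<lambda>k. 4 * \<omega> k", unfolded p]
    have core_prems:
      "\<And>k. k < D \<Longrightarrow> ?p k \<le> ?p (Suc k)"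
      "antimono_on {a<..<m1} ?u" "antimono_on {a..m1} g"
      "\<And>x y. a \<le> x \<Longrightarrow> x \<le> y \<Longrightarrow> y \<le> m1 \<Longrightarrow> (?u has_integral \<Phi> y - \<Phi> x) {x..y}"
      "\<And>x y. a \<le> x \<Longrightarrow> x \<le> y \<Longrightarrow> y \<le> m1 \<Longrightarrow> (g has_integral G y - G x) {x..y}"
      "\<And>x. x \<in> {a..m1} \<Longrightarrow> F x \<le> \<Phi> x"
    proof -
      show "?p k \<le> ?p (Suc k)" if "k < D" for k using ts_le[of k "Suc k"] that by auto
      show "antimono_on {a<..<m1} ?u" "antimono_on {a..m1} g"
        using anti g_left m1 by (auto simp: monotone_on_def)
    qed (use m1 m in \<open>auto intro!: int G ge\<close>)
    have touch': "\<Phi> x \<le> F x" if x: "x \<in> {a<..<m1}" and l: "\<And>y. a < y \<Longrightarrow> y < x \<Longrightarrow> d < ?u y"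
      and r: "\<And>y. x < y \<Longrightarrow> y < m1 \<Longrightarrow> ?u y \<le> d" for x d
    proof (rule touch)
      show "\<forall>\<^sub>F y in at_left x. d < ?u y"
        using eventually_at_left_real[of a x] x l by (auto elim: eventually_mono)
      show "\<forall>\<^sub>F y in at_right x. ?u y \<le> d"
        using eventually_at_right_real[of x m1] x r by (auto elim: eventually_mono)
    qed (use x m1 in auto)
    note core' = core[OF core_prems touch' osc_cell]
    have int_abs: "(\<lambda>t. \<bar>?u t - g t\<bar>) integrable_on {a..m1}" by (rule core'(1))
    have "integral {a..m1} (\<lambda>t. \<bar>?u t - g t\<bar>) \<le> (\<Phi> a - F a) + (\<Phi> m1 - F m1)
      + (\<Sum>k<D. 4 * \<omega> k) + 2 * (\<Sum>k<D. integral {?p k..?p (Suc k)} (\<lambda>x. \<bar>g x - c k\<bar>))"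
      by (rule core')
    also have "(\<Sum>k<D. integral {?p k..?p (Suc k)} (\<lambda>x. \<bar>g x - c k\<bar>))
        \<le> (\<Sum>k<D. integral {ts ! k..ts ! Suc k} (\<lambda>x. \<bar>g x - c k\<bar>))"
    proof (rule sum_mono)
      fix k assume k: "k \<in> {..<D}"
      show "integral {?p k..?p (Suc k)} (\<lambda>x. \<bar>g x - c k\<bar>)
          \<le> integral {ts ! k..ts ! Suc k} (\<lambda>x. \<bar>g x - c k\<bar>)"
      proof (cases "ts ! k < m1")
        case True
        then show ?thesis using k by (intro integral_sub_cell_le) auto
      next
        case False
        then have "?p k = m1" "?p (Suc k) = m1" using ts_le[of k "Suc k"] k by auto
        moreover have "0 \<le> integral {ts ! k..ts ! Suc k} (\<lambda>x. \<bar>g x - c k\<bar>)"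
          using ts_in[of k] ts_in[of "Suc k"] k by (intro integral_nonneg integrable_abs_diff) auto
        ultimately show ?thesis by simp
      qed
    qed
    also have "\<Phi> a - F a \<le> 0" using \<Phi>a by simp
    also have "\<Phi> m1 - F m1 \<le> 2 * \<Omega>" using le[of m1] d_S_\<mu> m1 by auto
    also have "(\<Sum>k<D. 4 * \<omega> k) = 4 * \<Omega>" by (simp add: \<Omega>_def sum_distrib_left)
    finally have "integral {a..m1} (\<lambda>t. \<bar>?u t - g t\<bar>)
      \<le> 6 * \<Omega> + 2 * (\<Sum>k<D. integral {ts ! k..ts ! Suc k} (\<lambda>t. \<bar>g t - c k\<bar>))" by simp
    with int_abs show ?thesis ..
  qed
  then show "(\<lambda>t. \<bar>U_S a b F t - g t\<bar>) integrable_on {a..m1}"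
    "integral {a..m1} (\<lambda>t. \<bar>U_S a b F t - g t\<bar>)
      \<le> 6 * \<Omega> + 2 * (\<Sum>k<D. integral {ts ! k..ts ! Suc k} (\<lambda>t. \<bar>g t - c k\<bar>))"
    by (simp_all add: U_S_def)
qed

text \<open>The oscillation on a cell also controls left limits, since \<open>G\<close> is continuous.\<close>

lemma left_limit_close:
  assumes k: "k < D" and x: "ts ! k < x" "x \<le> ts ! Suc k"
    and Fl: "\<forall>\<^sub>F y in at_left x. F y = Fl x"
  shows "\<bar>(Fl x - G x) - Z (ts ! k)\<bar> \<le> \<omega> k"
proof -
  have "a < x" "x \<le> b" using ts_in[of k] ts_in[of "Suc k"] k x by auto
  then have "((\<lambda>y. \<bar>(Fl x - G y) - Z (ts ! k)\<bar>) \<longlongrightarrow> \<bar>(Fl x - G x) - Z (ts ! k)\<bar>) (at_left x)"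
    by (intro tendsto_intros G_left_limit)
  moreover have "\<forall>\<^sub>F y in at_left x. \<bar>(Fl x - G y) - Z (ts ! k)\<bar> \<le> \<omega> k"
    using Fl eventually_at_left_real[OF x(1)]
  proof eventually_elim
    case (elim y)
    then show ?case using osc'[OF k, of y] x by auto
  qed
  ultimately show ?thesis by (rule tendsto_upperbound) simp
qed

text \<open>The mirror image of \<open>left_part\<close>. The touching values are left limits, and the left limit at the
  start of a cell belongs to the previous cell; the terms \<open>J k\<close> account for these jumps.\<close>

lemma right_part:
  assumes m2: "m2 \<in> {m..b}" "\<mu> \<le> m2"
  shows "(\<lambda>t. \<bar>U_S a b F t - g t\<bar>) integrable_on {m2..b}"
    and "integral {m2..b} (\<lambda>t. \<bar>U_S a b F t - g t\<bar>)
      \<le> 8 * \<Omega> + 2 * (\<Sum>k<D. integral {ts ! k..ts ! Suc k} (\<lambda>t. \<bar>g t - c k\<bar>))"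
proof -
  let ?u = "U_slope a b \<mu> F"
  let ?V = "\<Sum>k<D. integral {ts ! k..ts ! Suc k} (\<lambda>t. \<bar>g t - c k\<bar>)"
  let ?p = "\<lambda>k. max (ts ! k) m2"
  have cell_nonneg: "0 \<le> integral {ts ! k..ts ! Suc k} (\<lambda>x. \<bar>g x - c k\<bar>)" if "k < D" for k
    using ts_in[of k] ts_in[of "Suc k"] that by (intro integral_nonneg integrable_abs_diff) auto
  have "(\<lambda>t. \<bar>?u t - g t\<bar>) integrable_on {m2..b} \<and>
    integral {m2..b} (\<lambda>t. \<bar>?u t - g t\<bar>) \<le> 8 * \<Omega> + 2 * ?V"
  proof (cases "m2 = b")
    case True
    have "0 \<le> ?V" by (intro sum_nonneg cell_nonneg) auto
    moreover have "((\<lambda>t. \<bar>?u t - g t\<bar>) has_integral 0) {m2..b}"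
      using True has_integral_refl(1)[of _ b] by simp
    then have "(\<lambda>t. \<bar>?u t - g t\<bar>) integrable_on {m2..b}"
      "integral {m2..b} (\<lambda>t. \<bar>?u t - g t\<bar>) = 0"
      by (simp_all add: has_integral_iff)
    ultimately show ?thesis using \<Omega>_nonneg by simp
  next
    case False
    then have m2b: "m2 < b" "a \<le> m2" "\<mu> < b" using m2 m by auto
    obtain Fl where Fl: "\<And>x. a < x \<Longrightarrow> x \<le> b \<Longrightarrow> \<forall>\<^sub>F y in at_left x. F y = Fl x"
      using mono_steps_eventually_const_left[OF F] by blast
    \<comment> \<open>At \<open>m2\<close> the value of \<open>F\<close> is used, so that no jump at \<open>m2\<close> has to be paid for.\<close>
    define E where "E x = (if x \<le> m2 then - F x else - Fl x)" for x
    define J where "J k = (if k = 0 then 0 else 2 * \<omega> (k - 1))" for k :: nat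
    have p: "?p 0 = m2" "?p D = b"
      using ts_props(1,2) m2 m2b by (auto simp: max_def)
    have J_nonneg: "0 \<le> J k" if "k < D" for k
      using that \<omega>_nonneg[of "k - 1"] by (auto simp: J_def)
    have osc_cell: "2 * (E r - - G r) - (E (?p k) - - G (?p k)) - (E (?p (Suc k)) - - G (?p (Suc k)))
        \<le> 4 * \<omega> k + J k" if k: "k < D" and r: "r \<in> {?p k..?p (Suc k)}" for k r
    proof (cases "m2 < ts ! Suc k")
      case True
      let ?z = "- Z (ts ! k)"
      have lt: "ts ! k < ts ! Suc k" using ts_props(5)[of k "Suc k"] k by auto
      have inner: "\<bar>(E x - - G x) - ?z\<bar> \<le> \<omega> k" if x: "?p k < x" "x \<le> ts ! Suc k" for x
      proof -
        have "a < x" "x \<le> b" using x ts_in[of k] ts_in[of "Suc k"] k by auto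
        then have "\<bar>(Fl x - G x) - Z (ts ! k)\<bar> \<le> \<omega> k"
          using k x by (intro left_limit_close Fl) auto
        then show ?thesis using x by (auto simp: E_def)
      qed
      have start: "\<bar>(E (?p k) - - G (?p k)) - ?z\<bar> \<le> \<omega> k + J k"
      proof (cases "ts ! k \<le> m2")
        case True
        have "\<bar>Z m2 - Z (ts ! k)\<bar> \<le> \<omega> k"
          using True \<open>m2 < ts ! Suc k\<close> k by (intro osc') auto
        then show ?thesis using True J_nonneg[OF k] by (simp add: E_def)
      next
        case False
        then have "k \<noteq> 0" using m2b ts_props(1) by (intro notI) auto
        then obtain j where j: "k = Suc j" by (cases k) auto
        have jk: "j < D" "ts ! j < ts ! k" using j k ts_props(5)[of j k] by auto
        have "\<bar>(Fl (ts ! k) - G (ts ! k)) - Z (ts ! j)\<bar> \<le> \<omega> j"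
          using jk j ts_in[of k] ts_in[of j] k by (intro left_limit_close Fl) auto
        moreover have "\<bar>Z (ts ! k) - Z (ts ! j)\<bar> \<le> \<omega> j"
          using jk j by (intro osc') auto
        ultimately show ?thesis using False j \<omega>_nonneg[OF k] by (simp add: E_def J_def)
      qed
      have end': "?p (Suc k) = ts ! Suc k" using True by simp
      have last: "\<bar>(E (ts ! Suc k) - - G (ts ! Suc k)) - ?z\<bar> \<le> \<omega> k"
        using True lt by (intro inner) auto
      show ?thesis
      proof (cases "r = ?p k")
        case True
        show ?thesis unfolding True end' using start last \<omega>_nonneg[OF k] by argo
      next
        case False
        then have "?p k < r" "r \<le> ts ! Suc k" using r end' by auto
        from inner[OF this] show ?thesis unfolding end' using start last by argo
      qed
    next
      case False
      then have "?p k = m2" "?p (Suc k) = m2" using ts_le[of k "Suc k"] k by auto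
      then show ?thesis using r \<omega>_nonneg[OF k] J_nonneg[OF k] by auto
    qed
    have sum_J: "(\<Sum>k<D. J k) \<le> 2 * \<Omega>"
    proof (cases D)
      case (Suc n)
      have "(\<Sum>k<D. J k) = (\<Sum>k<n. 2 * \<omega> k)"
        unfolding Suc sum.lessThan_Suc_shift by (simp add: J_def)
      also have "\<dots> \<le> (\<Sum>k<D. 2 * \<omega> k)"
        using \<omega>_nonneg Suc by (intro sum_mono2) auto
      finally show ?thesis by (simp add: \<Omega>_def sum_distrib_left)
    qed (use \<Omega>_nonneg in simp)
    show ?thesis
    proof (rule U_slope_right_of_mode[OF F \<mu>_in Fl])
      fix \<Psi>
      assume anti: "antimono_on {\<mu><..<b} (\<lambda>x. - ?u x)"
        and int: "\<And>x y. \<mu> \<le> x \<Longrightarrow> x \<le> y \<Longrightarrow> y \<le> b \<Longrightarrow> ((\<lambda>x. - ?u x) has_integral \<Psi> y - \<Psi> x) {x..y}"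
        and ge: "\<And>x. \<mu> \<le> x \<Longrightarrow> x < b \<Longrightarrow> - F x \<le> \<Psi> x"
        and le: "\<And>x. \<mu> \<le> x \<Longrightarrow> x < b \<Longrightarrow> \<Psi> x \<le> - F x + d_S a b F \<mu>"
        and ge': "\<And>x. \<mu> < x \<Longrightarrow> x \<le> b \<Longrightarrow> - Fl x \<le> \<Psi> x"
        and touch: "\<And>x d. \<mu> < x \<Longrightarrow> x < b \<Longrightarrow> \<forall>\<^sub>F y in at_left x. d < - ?u y \<Longrightarrow>
          \<forall>\<^sub>F y in at_right x. - ?u y \<le> d \<Longrightarrow> \<Psi> x \<le> - Fl x"
        and \<Psi>b: "\<mu> < b \<Longrightarrow> \<Psi> b \<le> - Fl b"
      note core = monotone_slope_L1_bound[of D ?p "\<lambda>x. - ?u x" "\<lambda>x. - g x" \<Psi> "\<lambda>x. - G x" E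
        "\<lambda>k. 4 * \<omega> k + J k", unfolded p]
      have core_prems:
        "\<And>k. k < D \<Longrightarrow> ?p k \<le> ?p (Suc k)"
        "antimono_on {m2<..<b} (\<lambda>x. - ?u x)" "antimono_on {m2..b} (\<lambda>x. - g x)"
        "\<And>x y. m2 \<le> x \<Longrightarrow> x \<le> y \<Longrightarrow> y \<le> b \<Longrightarrow> ((\<lambda>x. - ?u x) has_integral \<Psi> y - \<Psi> x) {x..y}"
        "\<And>x y. m2 \<le> x \<Longrightarrow> x \<le> y \<Longrightarrow> y \<le> b \<Longrightarrow> ((\<lambda>x. - g x) has_integral - G y - - G x) {x..y}"
        "\<And>x. x \<in> {m2..b} \<Longrightarrow> E x \<le> \<Psi> x"
      proof -
        show "?p k \<le> ?p (Suc k)" if "k < D" for k using ts_le[of k "Suc k"] that by auto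
        show "antimono_on {m2<..<b} (\<lambda>x. - ?u x)" "antimono_on {m2..b} (\<lambda>x. - g x)"
          using anti g_right m2 by (auto simp: monotone_on_def)
        show "((\<lambda>x. - g x) has_integral - G y - - G x) {x..y}" if "m2 \<le> x" "x \<le> y" "y \<le> b" for x y
          using has_integral_neg[OF G[of x y]] that m2b by simp
        show "E x \<le> \<Psi> x" if "x \<in> {m2..b}" for x
          using that ge[of x] ge'[of x] m2 m2b by (cases "x = m2") (auto simp: E_def)
      qed (use m2 in \<open>auto intro!: int\<close>)
      have touch': "\<Psi> x \<le> E x" if x: "x \<in> {m2<..<b}" and l: "\<And>y. m2 < y \<Longrightarrow> y < x \<Longrightarrow> d < - ?u y"
        and r: "\<And>y. x < y \<Longrightarrow> y < b \<Longrightarrow> - ?u y \<le> d" for x d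
      proof -
        have "\<Psi> x \<le> - Fl x"
        proof (rule touch)
          show "\<forall>\<^sub>F y in at_left x. d < - ?u y"
            using eventually_at_left_real[of m2 x] x l by (auto elim: eventually_mono)
          show "\<forall>\<^sub>F y in at_right x. - ?u y \<le> d"
            using eventually_at_right_real[of x b] x r by (auto elim: eventually_mono)
        qed (use x m2 in auto)
        then show ?thesis using x by (simp add: E_def)
      qed
      note core' = core[OF core_prems touch' osc_cell]
      have swap: "\<bar>- x - - y\<bar> = \<bar>x - y\<bar>" for x y :: real by simp
      have int_abs: "(\<lambda>t. \<bar>- ?u t - - g t\<bar>) integrable_on {m2..b}" by (rule core'(1))
      have "integral {m2..b} (\<lambda>t. \<bar>- ?u t - - g t\<bar>) \<le> (\<Psi> m2 - E m2) + (\<Psi> b - E b)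
        + (\<Sum>k<D. 4 * \<omega> k + J k)
        + 2 * (\<Sum>k<D. integral {?p k..?p (Suc k)} (\<lambda>x. \<bar>- g x - - c k\<bar>))"
        by (rule core')
      also have "(\<Sum>k<D. integral {?p k..?p (Suc k)} (\<lambda>x. \<bar>- g x - - c k\<bar>)) \<le> ?V"
      proof (rule sum_mono)
        fix k assume k: "k \<in> {..<D}"
        show "integral {?p k..?p (Suc k)} (\<lambda>x. \<bar>- g x - - c k\<bar>)
            \<le> integral {ts ! k..ts ! Suc k} (\<lambda>x. \<bar>g x - c k\<bar>)"
        proof (cases "m2 < ts ! Suc k")
          case True
          then show ?thesis unfolding swap using k by (intro integral_sub_cell_le) auto
        next
          case False
          then have "?p k = m2" "?p (Suc k) = m2" using ts_le[of k "Suc k"] k by auto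
          then show ?thesis using cell_nonneg[of k] k by simp
        qed
      qed
      also have "\<Psi> b - E b \<le> 0" using \<Psi>b m2b by (simp add: E_def)
      also have "\<Psi> m2 - E m2 \<le> 2 * \<Omega>" using le[of m2] d_S_\<mu> m2 m2b by (auto simp: E_def)
      also have "(\<Sum>k<D. 4 * \<omega> k + J k) = 4 * \<Omega> + (\<Sum>k<D. J k)"
        by (simp add: \<Omega>_def sum_distrib_left sum.distrib)
      also have "\<dots> \<le> 6 * \<Omega>" using sum_J by simp
      finally have "integral {m2..b} (\<lambda>t. \<bar>?u t - g t\<bar>) \<le> 8 * \<Omega> + 2 * ?V"
        unfolding swap by simp
      with int_abs[unfolded swap] show ?thesis ..
    qed
  qed
  then show "(\<lambda>t. \<bar>U_S a b F t - g t\<bar>) integrable_on {m2..b}"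
    "integral {m2..b} (\<lambda>t. \<bar>U_S a b F t - g t\<bar>)
      \<le> 8 * \<Omega> + 2 * (\<Sum>k<D. integral {ts ! k..ts ! Suc k} (\<lambda>t. \<bar>g t - c k\<bar>))"
    by (simp_all add: U_S_def)
qed

text \<open>Between \<open>m\<close> and \<open>\<mu>\<close> the slope decreases while \<open>g\<close> increases. The primitive of their
  difference lies between \<open>Z a - \<Omega>\<close> and \<open>Z a + 3 \<Omega>\<close>, since \<open>Z\<close> is within
  \<open>\<Omega>\<close> of \<open>Z a\<close> and \<open>\<Phi> - F\<close> is at most \<open>2 \<Omega>\<close>.\<close>

lemma middle_part_after_mode:
  assumes "m \<le> \<mu>"
  shows "(\<lambda>t. \<bar>U_S a b F t - g t\<bar>) integrable_on {m..\<mu>}"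
    and "integral {m..\<mu>} (\<lambda>t. \<bar>U_S a b F t - g t\<bar>) \<le> 8 * \<Omega>"
proof -
  let ?u = "U_slope a b \<mu> F"
  have "\<exists>I. ((\<lambda>t. \<bar>?u t - g t\<bar>) has_integral I) {m..\<mu>} \<and> I \<le> 8 * \<Omega>"
  proof (rule U_slope_left_of_mode[OF F \<mu>_in])
    fix \<Phi>
    assume anti: "antimono_on {a<..<\<mu>} ?u"
      and int: "\<And>x y. a \<le> x \<Longrightarrow> x \<le> y \<Longrightarrow> y \<le> \<mu> \<Longrightarrow> (?u has_integral \<Phi> y - \<Phi> x) {x..y}"
      and ge: "\<And>x. x \<in> {a..\<mu>} \<Longrightarrow> F x \<le> \<Phi> x"
      and le: "\<And>x. x \<in> {a..\<mu>} \<Longrightarrow> \<Phi> x \<le> F x + d_S a b F \<mu>"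
    have mono: "antimono_on {m<..<\<mu>} (\<lambda>x. ?u x - g x)"
      using anti g_right m \<mu>_in unfolding monotone_on_def
      by (auto intro!: diff_mono)
    have "((\<lambda>x. ?u x - g x) has_integral (\<Phi> y - G y) - (\<Phi> x - G x)) {x..y}"
      if "m \<le> x" "x \<le> y" "y \<le> \<mu>" for x y
      using has_integral_diff[OF int[of x y] G[of x y]] that m \<mu>_in by (simp add: algebra_simps)
    from has_integral_abs_antimono[OF assms mono this]
    obtain r where r: "r \<in> {m..\<mu>}"
      "((\<lambda>x. \<bar>?u x - g x\<bar>) has_integral 2 * (\<Phi> r - G r) - (\<Phi> m - G m) - (\<Phi> \<mu> - G \<mu>)) {m..\<mu>}"
      by blast
    have bounds: "Z a - \<Omega> \<le> \<Phi> x - G x" "\<Phi> x - G x \<le> Z a + 3 * \<Omega>" if "x \<in> {m..\<mu>}" for x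
      using Z_close[of x] ge[of x] le[of x] d_S_\<mu> that m \<mu>_in by auto
    have "2 * (\<Phi> r - G r) - (\<Phi> m - G m) - (\<Phi> \<mu> - G \<mu>) \<le> 8 * \<Omega>"
      using bounds[of r] bounds[of m] bounds[of \<mu>] r(1) assms by auto
    then show ?thesis using r(2) by blast
  qed
  then show "(\<lambda>t. \<bar>U_S a b F t - g t\<bar>) integrable_on {m..\<mu>}"
    "integral {m..\<mu>} (\<lambda>t. \<bar>U_S a b F t - g t\<bar>) \<le> 8 * \<Omega>"
    by (auto simp: U_S_def integrable_on_def integral_unique)
qed

lemma middle_part_before_mode:
  assumes "\<mu> \<le> m"
  shows "(\<lambda>t. \<bar>U_S a b F t - g t\<bar>) integrable_on {\<mu>..m}"
    and "integral {\<mu>..m} (\<lambda>t. \<bar>U_S a b F t - g t\<bar>) \<le> 8 * \<Omega>"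
proof -
  let ?u = "U_slope a b \<mu> F"
  obtain Fl where Fl: "\<And>x. a < x \<Longrightarrow> x \<le> b \<Longrightarrow> \<forall>\<^sub>F y in at_left x. F y = Fl x"
    using mono_steps_eventually_const_left[OF F] by blast
  have "\<exists>I. ((\<lambda>t. \<bar>- ?u t + g t\<bar>) has_integral I) {\<mu>..m} \<and> I \<le> 8 * \<Omega>"
  proof (rule U_slope_right_of_mode[OF F \<mu>_in Fl])
    fix \<Psi>
    assume anti: "antimono_on {\<mu><..<b} (\<lambda>x. - ?u x)"
      and int: "\<And>x y. \<mu> \<le> x \<Longrightarrow> x \<le> y \<Longrightarrow> y \<le> b \<Longrightarrow> ((\<lambda>x. - ?u x) has_integral \<Psi> y - \<Psi> x) {x..y}"
      and ge: "\<And>x. \<mu> \<le> x \<Longrightarrow> x < b \<Longrightarrow> - F x \<le> \<Psi> x"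
      and le: "\<And>x. \<mu> \<le> x \<Longrightarrow> x < b \<Longrightarrow> \<Psi> x \<le> - F x + d_S a b F \<mu>"
      and ge': "\<And>x. \<mu> < x \<Longrightarrow> x \<le> b \<Longrightarrow> - Fl x \<le> \<Psi> x"
      and \<Psi>b: "\<mu> < b \<Longrightarrow> \<Psi> b \<le> - Fl b" "\<mu> = b \<Longrightarrow> \<Psi> b = - F b"
    have mono: "antimono_on {\<mu><..<m} (\<lambda>x. - ?u x + g x)"
      using anti g_left m \<mu>_in unfolding monotone_on_def
      by (auto intro!: diff_mono)
    have "((\<lambda>x. - ?u x + g x) has_integral (\<Psi> y + G y) - (\<Psi> x + G x)) {x..y}"
      if "\<mu> \<le> x" "x \<le> y" "y \<le> m" for x y
      using has_integral_add[OF int[of x y] G[of x y]] that m \<mu>_in by (simp add: algebra_simps)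
    from has_integral_abs_antimono[OF assms mono this]
    obtain r where r: "r \<in> {\<mu>..m}"
      "((\<lambda>x. \<bar>- ?u x + g x\<bar>) has_integral 2 * (\<Psi> r + G r) - (\<Psi> \<mu> + G \<mu>) - (\<Psi> m + G m)) {\<mu>..m}"
      by blast
    have bounds: "- Z a - \<Omega> \<le> \<Psi> x + G x \<and> \<Psi> x + G x \<le> - Z a + 3 * \<Omega>" if x: "x \<in> {\<mu>..m}" for x
    proof -
      consider "x < b" | "x = b" "\<mu> = b" | "x = b" "\<mu> < b" using x m \<mu>_in by force
      then show ?thesis
      proof cases
        case 1
        then show ?thesis using Z_close[of x] ge[of x] le[of x] d_S_\<mu> x m \<mu>_in by auto
      next
        case 2
        then show ?thesis using Z_close[of b] \<Psi>b(2) \<Omega>_nonneg ab by auto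
      next
        case 3
        have "((\<lambda>y. \<bar>(Fl b - G y) - Z a\<bar>) \<longlongrightarrow> \<bar>(Fl b - G b) - Z a\<bar>) (at_left b)"
          using ab by (intro tendsto_intros G_left_limit) auto
        moreover have "\<forall>\<^sub>F y in at_left b. \<bar>(Fl b - G y) - Z a\<bar> \<le> \<Omega>"
          using Fl[OF ab order_refl] eventually_at_left_real[OF ab]
        proof eventually_elim
          case (elim y)
          then show ?case using Z_close[of y] by auto
        qed
        ultimately have "\<bar>(Fl b - G b) - Z a\<bar> \<le> \<Omega>" by (rule tendsto_upperbound) simp
        then show ?thesis using \<Psi>b(1) ge'[of b] 3 \<Omega>_nonneg by auto
      qed
    qed
    have "2 * (\<Psi> r + G r) - (\<Psi> \<mu> + G \<mu>) - (\<Psi> m + G m) \<le> 8 * \<Omega>"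
      using bounds[of r] bounds[of m] bounds[of \<mu>] r(1) assms by auto
    then show ?thesis using r(2) by blast
  qed
  moreover have "\<bar>- x + y\<bar> = \<bar>x - y\<bar>" for x y :: real by simp
  ultimately show "(\<lambda>t. \<bar>U_S a b F t - g t\<bar>) integrable_on {\<mu>..m}"
    "integral {\<mu>..m} (\<lambda>t. \<bar>U_S a b F t - g t\<bar>) \<le> 8 * \<Omega>"
    by (auto simp: U_S_def integrable_on_def integral_unique)
qed

text \<open>The three parts contribute \<open>6 \<Omega>\<close>, \<open>8 \<Omega>\<close> and \<open>8 \<Omega>\<close>. The outer two each
  contribute twice the distance of \<open>g\<close> to the step function with values \<open>c k\<close>.\<close>

lemma U_S_L1_bound:
  "(\<lambda>t. \<bar>U_S a b F t - g t\<bar>) integrable_on {a..b}"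
  "integral {a..b} (\<lambda>t. \<bar>U_S a b F t - g t\<bar>)
    \<le> 4 * (\<Sum>k<D. integral {ts ! k..ts ! Suc k} (\<lambda>t. \<bar>g t - c k\<bar>)) + 22 * \<Omega>"
proof -
  let ?d = "\<lambda>t. \<bar>U_S a b F t - g t\<bar>"
  define m1 where "m1 = min m \<mu>"
  define m2 where "m2 = max m \<mu>"
  have m12: "m1 \<in> {a..m}" "m1 \<le> \<mu>" "m2 \<in> {m..b}" "\<mu> \<le> m2" "m1 \<le> m2"
    using m \<mu>_in by (auto simp: m1_def m2_def)
  have mid: "?d integrable_on {m1..m2}" "integral {m1..m2} ?d \<le> 8 * \<Omega>"
    using middle_part_after_mode middle_part_before_mode
    by (cases "m \<le> \<mu>"; auto simp: m1_def m2_def min_def max_def)+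
  note left = left_part[OF m12(1,2)] and right = right_part[OF m12(3,4)]
  have int2: "?d integrable_on {a..m2}"
    using m12 by (intro Henstock_Kurzweil_Integration.integrable_combine[OF _ _ left(1) mid(1)]) auto
  show int3: "?d integrable_on {a..b}"
    using m12 m by (intro Henstock_Kurzweil_Integration.integrable_combine[OF _ _ int2 right(1)]) auto
  have "integral {a..b} ?d = integral {a..m1} ?d + integral {m1..m2} ?d + integral {m2..b} ?d"
    using Henstock_Kurzweil_Integration.integral_combine[OF _ _ int2, of m1]
      Henstock_Kurzweil_Integration.integral_combine[OF _ _ int3, of m2] m12 m by auto
  then show "integral {a..b} ?d
    \<le> 4 * (\<Sum>k<D. integral {ts ! k..ts ! Suc k} (\<lambda>t. \<bar>g t - c k\<bar>)) + 22 * \<Omega>"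
    using left(2)[of c] mid(2) right(2)[of c] by linarith
qed

end

section \<open>Integration over the samples\<close>

lemma u_shaped_set_integrable:
  fixes g :: "real \<Rightarrow> real"
  assumes m: "m \<in> {a..b}" and anti: "antimono_on {a..m} g" and mono: "mono_on {m..b} g"
    and t: "t \<in> {a..b}"
  shows "set_integrable lborel {a..t} g"
proof -
  have "mono_on {a..m} (\<lambda>x. - g x)" using anti by (auto simp: monotone_on_def)
  then have "(\<lambda>x. - (- g x)) \<in> borel_measurable (restrict_space borel {a..m})"
    by (intro borel_measurable_uminus borel_measurable_mono_on_fnc)
  then have g1: "(\<lambda>x. indicator {a..m} x *\<^sub>R g x) \<in> borel_measurable borel"
    by (simp add: borel_measurable_restrict_space_iff)
  have "g \<in> borel_measurable (restrict_space borel {m..b})"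
    using mono by (rule borel_measurable_mono_on_fnc)
  then have g2: "(\<lambda>x. indicator {m..b} x *\<^sub>R g x) \<in> borel_measurable borel"
    by (simp add: borel_measurable_restrict_space_iff)
  let ?g = "\<lambda>x. if x \<le> m then indicator {a..m} x *\<^sub>R g x else indicator {m..b} x *\<^sub>R g x"
  have "?g \<in> borel_measurable borel"
    using g1 g2 by (intro measurable_If) auto
  moreover have "norm (?g x) \<le> \<bar>g a\<bar> + \<bar>g b\<bar> + \<bar>g m\<bar>" if "x \<in> {a..t}" for x
  proof (cases "x \<le> m")
    case True
    then have "g m \<le> g x" "g x \<le> g a"
      using monotone_onD[OF anti, of a x] monotone_onD[OF anti, of x m] m that by auto
    then show ?thesis using True that by simp
  next
    case False
    then have "g m \<le> g x" "g x \<le> g b"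
      using monotone_onD[OF mono, of x b] monotone_onD[OF mono, of m x] m t that by auto
    then show ?thesis using False that t by simp
  qed
  ultimately have int: "integrable lborel (\<lambda>x. indicator {a..t} x *\<^sub>R ?g x)"
    using t by (intro integrableI_bounded_set_indicator[where B="\<bar>g a\<bar> + \<bar>g b\<bar> + \<bar>g m\<bar>"]) auto
  have "(\<lambda>x. indicator {a..t} x *\<^sub>R ?g x) = (\<lambda>x. indicator {a..t} x *\<^sub>R g x)"
    using t m by (auto simp: indicator_def)
  with int show ?thesis unfolding set_integrable_def by (rule subst[rotated])
qed

lemma has_integral_primitive:
  assumes int: "\<And>t. t \<in> {a..b} \<Longrightarrow> set_integrable lborel {a..t} g"
    and xy: "a \<le> x" "x \<le> y" "y \<le> b"
  shows "(g has_integral primitive a g y - primitive a g x) {x..y}"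
proof -
  have prim: "primitive a g t = integral {a..t} g" "g integrable_on {a..t}" if "t \<in> {a..b}" for t
    using set_borel_integral_eq_integral[OF int[OF that]] by (simp_all add: primitive_def)
  have "integral {a..x} g + integral {x..y} g = integral {a..y} g"
    using prim(2)[of y] xy by (intro Henstock_Kurzweil_Integration.integral_combine) auto
  moreover have "g integrable_on {x..y}"
    by (rule integrable_on_subinterval[OF prim(2)[of y]]) (use xy in auto)
  ultimately show ?thesis
    using prim(1)[of x] prim(1)[of y] xy by (auto simp: has_integral_iff)
qed

lemma continuous_on_primitive:
  assumes int: "\<And>t. t \<in> {a..b} \<Longrightarrow> set_integrable lborel {a..t} g" and "a \<le> b"
  shows "continuous_on {a..b} (primitive a g)"
proof -
  have prim: "integral {a..t} g = primitive a g t" "g integrable_on {a..t}" if "t \<in> {a..b}" for t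
    using set_borel_integral_eq_integral[OF int[OF that]] by (simp_all add: primitive_def)
  have "continuous_on {a..b} (\<lambda>t. integral {a..t} g)"
    using prim(2)[of b] assms(2) by (intro indefinite_integral_continuous_1) auto
  then show ?thesis by (rule continuous_on_eq) (use prim(1) in auto)
qed

text \<open>Right-continuity makes the supremum over the interval a countable one; the point \<open>t\<close>,
  where \<open>F\<close> may jump, has to be added to the rationals.\<close>

lemma SUP_increment_rational:
  fixes F G :: "real \<Rightarrow> real"
  assumes F: "F \<in> mono_steps a b" and G: "continuous_on {a..b} G"
    and st: "a \<le> s" "s < t" "t \<le> b"
  shows "(SUP x\<in>{s..t}. ennreal \<bar>(F x - G x) - c\<bar>)
    = (SUP x\<in>insert t ({s..t} \<inter> \<rat>). ennreal \<bar>(F x - G x) - c\<bar>)"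
proof (rule antisym)
  let ?h = "\<lambda>x. ennreal \<bar>(F x - G x) - c\<bar>"
  let ?S = "SUP x\<in>insert t ({s..t} \<inter> \<rat>). ?h x"
  show "(SUP x\<in>{s..t}. ?h x) \<le> ?S"
  proof (rule SUP_least)
    fix x assume x: "x \<in> {s..t}"
    show "?h x \<le> ?S"
    proof (cases "x = t")
      case False
      then have x': "x < t" "s \<le> x" using x by auto
      have "(G \<longlongrightarrow> G x) (at x within {a..b})"
        using G x st by (simp add: continuous_on_def)
      then have "(G \<longlongrightarrow> G x) (at x within {x..b})"
        by (rule tendsto_within_subset) (use x st in auto)
      then have "(G \<longlongrightarrow> G x) (at_right x)"
        using x' st by (simp add: at_within_Icc_at_right)
      moreover have "(F \<longlongrightarrow> F x) (at_right x)"
        by (rule tendsto_eventually[OF mono_steps_eventually_const_right[OF F]]) (use x' st in auto)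
      ultimately have lim: "(?h \<longlongrightarrow> ?h x) (at_right x)"
        by (intro tendsto_intros)
      show ?thesis
      proof (rule dense_le)
        fix d assume "d < ?h x"
        then have "\<forall>\<^sub>F y in at_right x. d < ?h y" by (rule order_tendstoD(1)[OF lim])
        then obtain q where q: "x < q" "\<And>y. x < y \<Longrightarrow> y < q \<Longrightarrow> d < ?h y"
          unfolding eventually_at_right_field by blast
        obtain y where y: "y \<in> \<rat>" "x < y" "y < min q t"
          using Rats_dense_in_real[of x "min q t"] q x' by auto
        then have "d \<le> ?h y" using q(2)[of y] by simp
        also have "\<dots> \<le> ?S" by (rule SUP_upper) (use y x' in auto)
        finally show "d \<le> ?S" .
      qed
    qed (auto intro!: SUP_upper)
  qed
  show "?S \<le> (SUP x\<in>{s..t}. ?h x)"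
    by (rule SUP_subset_mono) (use st in auto)
qed

lemma SUP_increment_measurable:
  assumes "estimator a b N Ghat" and X: "X \<in> measurable M N" and G: "continuous_on {a..b} G"
    and st: "a \<le> s" "s < t" "t \<le> b"
  shows "(\<lambda>w. SUP x\<in>{s..t}. ennreal \<bar>(Ghat (X w) x - G x) - (Ghat (X w) s - G s)\<bar>) \<in> borel_measurable M"
proof -
  have steps: "Ghat (X w) \<in> mono_steps a b" if "w \<in> space M" for w
    using assms(1) measurable_space[OF X that] by (auto simp: estimator_def)
  have [measurable]: "(\<lambda>w. Ghat (X w) x) \<in> borel_measurable M" if "x \<in> {s..t}" for x
    using assms(1) that st
    by (intro measurable_compose[OF X, of "\<lambda>y. Ghat y x"]) (auto simp: estimator_def)
  have "(\<lambda>w. SUP x\<in>insert t ({s..t} \<inter> \<rat>).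
      ennreal \<bar>(Ghat (X w) x - G x) - (Ghat (X w) s - G s)\<bar>) \<in> borel_measurable M"
    using st by (intro borel_measurable_SUP) (auto intro!: countable_Int2 countable_rat)
  then show ?thesis
    using SUP_increment_rational[OF steps G st]
    by (subst measurable_cong) auto
qed

context step_estimate
begin

lemma has_integral_abs_diff_step:
  assumes h: "\<And>k. k < D \<Longrightarrow> h constant_on {ts ! k..<ts ! Suc k}"
  shows "((\<lambda>t. \<bar>g t - h t\<bar>) has_integral
    (\<Sum>k<D. integral {ts ! k..ts ! Suc k} (\<lambda>t. \<bar>g t - h (ts ! k)\<bar>))) {a..b}"
proof -
  have "((\<lambda>t. \<bar>g t - h t\<bar>) has_integral
      (\<Sum>k<n. integral {ts ! k..ts ! Suc k} (\<lambda>t. \<bar>g t - h (ts ! k)\<bar>))) {a..ts ! n}" if "n \<le> D" for n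
    using that
  proof (induction n)
    case 0
    show ?case using ts_props(1) has_integral_refl(2)[of _ a] by simp
  next
    case (Suc n)
    have lt: "ts ! n < ts ! Suc n" using ts_props(5)[of n "Suc n"] Suc.prems by auto
    have "(\<lambda>t. \<bar>g t - h (ts ! n)\<bar>) integrable_on {ts ! n..ts ! Suc n}"
      using ts_in[of n] ts_in[of "Suc n"] Suc.prems by (intro integrable_abs_diff) auto
    then have "((\<lambda>t. \<bar>g t - h (ts ! n)\<bar>) has_integral
        integral {ts ! n..ts ! Suc n} (\<lambda>t. \<bar>g t - h (ts ! n)\<bar>)) {ts ! n..ts ! Suc n}"
      by (rule integrable_integral)
    then have "((\<lambda>t. \<bar>g t - h t\<bar>) has_integral
        integral {ts ! n..ts ! Suc n} (\<lambda>t. \<bar>g t - h (ts ! n)\<bar>)) {ts ! n..ts ! Suc n}"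
    proof (rule has_integral_spike_finite[where S="{ts ! Suc n}", rotated 2])
      fix t assume t: "t \<in> {ts ! n..ts ! Suc n} - {ts ! Suc n}"
      obtain e where e: "\<forall>t\<in>{ts ! n..<ts ! Suc n}. h t = e"
        using h[of n] Suc.prems by (auto simp: constant_on_def)
      then have "h t = h (ts ! n)" using t lt by auto
      then show "\<bar>g t - h t\<bar> = \<bar>g t - h (ts ! n)\<bar>" by simp
    qed simp
    with Suc show ?case
      using lt ts_in[of n] by (auto intro!: has_integral_combine[where c="ts ! n"])
  qed
  from this[of D] show ?thesis using ts_props(2) by simp
qed

lemma L1_dist_U_S_le:
  assumes h: "\<And>k. k < D \<Longrightarrow> h constant_on {ts ! k..<ts ! Suc k}"
  shows "L1_dist a b (U_S a b F) g \<le> 4 * L1_dist a b g h + ennreal (22 * \<Omega>)"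
proof -
  define V where "V = (\<Sum>k<D. integral {ts ! k..ts ! Suc k} (\<lambda>t. \<bar>g t - h (ts ! k)\<bar>))"
  have V: "L1_dist a b g h = ennreal V"
    unfolding L1_dist_def V_def
    by (rule nn_integral_has_integral_lebesgue'[OF _ has_integral_abs_diff_step[OF h]]) auto
  have "0 \<le> V"
    by (rule has_integral_nonneg[OF has_integral_abs_diff_step[OF h], folded V_def]) auto
  have "L1_dist a b (U_S a b F) g = ennreal (integral {a..b} (\<lambda>t. \<bar>U_S a b F t - g t\<bar>))"
    unfolding L1_dist_def
    by (rule nn_integral_has_integral_lebesgue'[OF _ integrable_integral[OF U_S_L1_bound(1)]]) auto
  also have "\<dots> \<le> ennreal (4 * V + 22 * \<Omega>)"
    unfolding V_def by (intro ennreal_leI U_S_L1_bound(2))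
  also have "\<dots> = 4 * L1_dist a b g h + ennreal (22 * \<Omega>)"
    unfolding V using \<open>0 \<le> V\<close> \<Omega>_nonneg
    by (simp add: ennreal_plus ennreal_mult)
  finally show ?thesis .
qed

end

text \<open>If one of the suprema is infinite, there is nothing to show; otherwise they are the real
  oscillations \<open>\<omega> k\<close> of the estimate for a fixed sample.\<close>

lemma pointwise_risk_bound:
  fixes a b :: real and g F :: "real \<Rightarrow> real"
  assumes ab: "a < b" and g: "u_shaped a b g" and F: "F \<in> mono_steps a b"
    and ts: "ts \<in> partitions a b" and h: "h \<in> steps_of a b ts"
  defines "S \<equiv> \<lambda>k. SUP t\<in>{ts ! (k - 1)..ts ! k}.
    ennreal \<bar>(F t - primitive a g t) - (F (ts ! (k - 1)) - primitive a g (ts ! (k - 1)))\<bar>"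
  shows "L1_dist a b (U_S a b F) g \<le> 4 * L1_dist a b g h + 49 * (\<Sum>k\<in>{1..<length ts}. S k)"
proof (cases "\<exists>k\<in>{1..<length ts}. S k = \<top>")
  case True
  then obtain k where k: "k \<in> {1..<length ts}" "S k = \<top>" by blast
  then have "\<top> \<le> (\<Sum>k\<in>{1..<length ts}. S k)"
    using member_le_sum[of k "{1..<length ts}" S] by simp
  then have "(\<Sum>k\<in>{1..<length ts}. S k) = \<top>" by (simp only: top_unique)
  then show ?thesis by (simp only: ennreal_mult_eq_top_iff add_top_right_ennreal) simp
next
  case False
  note P = partition_props[OF ts]
  define \<omega> where "\<omega> k = enn2real (S (Suc k))" for k
  have S: "S (Suc k) = ennreal (\<omega> k)" if "Suc k < length ts" for k
    using False that by (simp add: \<omega>_def less_top)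
  obtain m where m: "m \<in> {a..b}" "antimono_on {a..m} g" "mono_on {m..b} g"
    using g by (auto simp: u_shaped_def)
  interpret step_estimate a b m g F "primitive a g" ts \<omega>
  proof
    show "(g has_integral primitive a g y - primitive a g x) {x..y}" if "a \<le> x" "x \<le> y" "y \<le> b" for x y
      by (rule has_integral_primitive[OF u_shaped_set_integrable[OF m] that])
    fix k x assume k: "Suc k < length ts" and x: "x \<in> {ts ! k..ts ! Suc k}"
    have "ennreal \<bar>(F x - primitive a g x) - (F (ts ! k) - primitive a g (ts ! k))\<bar> \<le> S (Suc k)"
      unfolding S_def diff_Suc_1 by (rule SUP_upper[OF x])
    then show "\<bar>(F x - primitive a g x) - (F (ts ! k) - primitive a g (ts ! k))\<bar> \<le> \<omega> k"
      unfolding S[OF k] by (simp add: \<omega>_def)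
  qed (fact ab m F ts)+
  have "h constant_on {ts ! k..<ts ! Suc k}" if "k < length ts - 1" for k
    using h that by (force simp: steps_of_def dest: bspec[of _ _ "Suc k"])
  then have "L1_dist a b (U_S a b F) g \<le> 4 * L1_dist a b g h + ennreal (22 * \<Omega>)"
    by (rule L1_dist_U_S_le)
  also have "ennreal (22 * \<Omega>) \<le> ennreal (49 * \<Omega>)"
    using \<Omega>_nonneg by (intro ennreal_leI) simp
  also have "ennreal (49 * \<Omega>) = 49 * ennreal \<Omega>"
    using \<Omega>_nonneg by (simp add: ennreal_mult)
  also have "ennreal \<Omega> = (\<Sum>k<length ts - 1. S (Suc k))"
    unfolding \<Omega>_def using \<omega>_nonneg S by (subst sum_ennreal[symmetric]) auto
  also have "\<dots> = (\<Sum>k\<in>{1..<length ts}. S k)"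
    using P(3,4) by (simp add: lessThan_atLeast0 sum.shift_bounds_Suc_ivl[symmetric] del: sum.op_ivl_Suc)
  finally show ?thesis by (simp add: add_left_mono)
qed

lemma le_add_INF_ennreal:
  fixes f :: "'a \<Rightarrow> ennreal"
  assumes "\<And>i. i \<in> I \<Longrightarrow> x \<le> 4 * f i + c"
  shows "x \<le> 4 * (INF i\<in>I. f i) + c"
proof (cases "c = \<top>")
  case False
  have "(x - c) / 4 \<le> (INF i\<in>I. f i)"
  proof (rule INF_greatest)
    fix i assume "i \<in> I"
    then have "x - c \<le> f i * 4"
      using assms[of i] False by (simp add: ennreal_minus_le_iff ac_simps)
    then show "(x - c) / 4 \<le> f i" by (intro divide_le_posI_ennreal) (simp_all add: ac_simps)
  qed
  then have "4 * ((x - c) / 4) \<le> 4 * (INF i\<in>I. f i)" by (rule mult_left_mono) simp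
  moreover have "4 * ((x - c) / 4) = x - c"
    by (simp add: ennreal_times_divide ennreal_mult_divide_eq mult.commute)
  ultimately have "x - c \<le> 4 * (INF i\<in>I. f i)" by simp
  then show ?thesis using False by (simp add: ennreal_minus_le_iff ac_simps)
qed simp

theorem theorem2:
  fixes a b :: real and g :: "real \<Rightarrow> real"
    and M :: "'w measure" and N :: "'x measure"
    and X :: "'w \<Rightarrow> 'x" and Ghat :: "'x \<Rightarrow> real \<Rightarrow> real"
  assumes "a < b"
    and "u_shaped a b g"
    and "prob_space M"
    and "X \<in> measurable M N"
    and "estimator a b N Ghat"
  shows "(\<integral>\<^sup>+w. L1_dist a b (U_S a b (Ghat (X w))) g \<partial>M)
    \<le> (INF ts\<in>partitions a b.
          risk_bound 49 M a b g (\<lambda>w t. Ghat (X w) t - primitive a g t) ts)"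
proof (rule INF_greatest)
  fix ts assume ts: "ts \<in> partitions a b"
  interpret prob_space M by (fact assms(3))
  let ?G = "primitive a g"
  let ?S = "\<lambda>k w. SUP t\<in>{ts ! (k - 1)..ts ! k}.
    ennreal \<bar>(Ghat (X w) t - ?G t) - (Ghat (X w) (ts ! (k - 1)) - ?G (ts ! (k - 1)))\<bar>"
  obtain m where m: "m \<in> {a..b}" "antimono_on {a..m} g" "mono_on {m..b} g"
    using assms(2) by (auto simp: u_shaped_def)
  have cont: "continuous_on {a..b} ?G"
    using assms(1) by (intro continuous_on_primitive u_shaped_set_integrable[OF m]) auto
  note P = partition_props[OF ts]
  have meas: "?S k \<in> borel_measurable M" if k: "k \<in> {1..<length ts}" for k
  proof (rule SUP_increment_measurable[OF assms(5,4) cont])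
    show "a \<le> ts ! (k - 1)"
    proof (cases "k = 1")
      case False
      then have "ts ! 0 < ts ! (k - 1)" using k by (intro P(5)) auto
      then show ?thesis using P(1) by simp
    qed (use P(1) in simp)
    show "ts ! (k - 1) < ts ! k" using P(4) P(5)[of "k - 1" k] k by auto
    show "ts ! k \<le> b"
    proof (cases "k = length ts - 1")
      case False
      then have "ts ! k < ts ! (length ts - 1)" using k by (intro P(5)) auto
      then show ?thesis using P(2) by simp
    qed (use P(2) in simp)
  qed
  show "(\<integral>\<^sup>+w. L1_dist a b (U_S a b (Ghat (X w))) g \<partial>M)
    \<le> risk_bound 49 M a b g (\<lambda>w t. Ghat (X w) t - ?G t) ts"
    unfolding risk_bound_def L1_setdist_def
  proof (rule le_add_INF_ennreal)
    fix h assume h: "h \<in> steps_of a b ts"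
    have "(\<integral>\<^sup>+w. L1_dist a b (U_S a b (Ghat (X w))) g \<partial>M)
      \<le> (\<integral>\<^sup>+w. 4 * L1_dist a b g h + 49 * (\<Sum>k\<in>{1..<length ts}. ?S k w) \<partial>M)"
    proof (rule nn_integral_mono)
      fix w assume "w \<in> space M"
      then have "Ghat (X w) \<in> mono_steps a b"
        using assms(4,5) measurable_space[OF assms(4)] by (auto simp: estimator_def)
      then show "L1_dist a b (U_S a b (Ghat (X w))) g
          \<le> 4 * L1_dist a b g h + 49 * (\<Sum>k\<in>{1..<length ts}. ?S k w)"
        by (rule pointwise_risk_bound[OF assms(1,2) _ ts h])
    qed
    also have "\<dots> = 4 * L1_dist a b g h + 49 * (\<Sum>k\<in>{1..<length ts}. \<integral>\<^sup>+w. ?S k w \<partial>M)"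
    proof -
      have sum_meas: "(\<lambda>w. \<Sum>k\<in>{1..<length ts}. ?S k w) \<in> borel_measurable M"
        by (intro borel_measurable_sum meas)
      then have "(\<integral>\<^sup>+w. 4 * L1_dist a b g h + 49 * (\<Sum>k\<in>{1..<length ts}. ?S k w) \<partial>M)
          = (\<integral>\<^sup>+w. 4 * L1_dist a b g h \<partial>M) + (\<integral>\<^sup>+w. 49 * (\<Sum>k\<in>{1..<length ts}. ?S k w) \<partial>M)"
        by (intro nn_integral_add borel_measurable_times_ennreal) auto
      also have "(\<integral>\<^sup>+w. 49 * (\<Sum>k\<in>{1..<length ts}. ?S k w) \<partial>M)
          = 49 * (\<Sum>k\<in>{1..<length ts}. \<integral>\<^sup>+w. ?S k w \<partial>M)"
        unfolding nn_integral_cmult[OF sum_meas]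
        by (rule arg_cong[where f="\<lambda>x. 49 * x"]) (rule nn_integral_sum[OF meas])
      finally show ?thesis by (simp add: emeasure_space_1)
    qed
    finally show "(\<integral>\<^sup>+w. L1_dist a b (U_S a b (Ghat (X w))) g \<partial>M)
      \<le> 4 * L1_dist a b g h + ennreal 49 * (\<Sum>k\<in>{1..<length ts}. \<integral>\<^sup>+w. ?S k w \<partial>M)" by simp
  qed
qed

end
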